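(* Let $G$ be an out-degree $\aleph_0$-regular Borel graph with countable in-degrees on a Borel probability space $(X,\mu)$ of vertices. Then $G$ admits a $\mu$-measurable domatic $\aleph_0$-partition.
   Context: A Borel probability space $(X,\mu)$ is a standard Borel space $X$ with a Borel probability measure $\mu$. A Borel graph on $X$ is a Borel subset $G\subseteq X^2$, viewed as the edge set of a directed graph with possible loops. The out-neighborhood of $x$ is $N_G(x)=\{y\in X:(x,y)\in G\}$. Out-degree $\aleph_0$-regular means $|N_G(x)|=\aleph_0$ for every $x\in X$; countable in-degrees means $\{y\in X:(y,x)\in G\}$ is countable for every $x\in X$. A $\mu$-measurable domatic $\aleph_0$-partition is a sequence $\langle D_j:j\in\mathbb{N}\rangle$ of pairwise-disjoint $\mu$-measurable subsets of $X$ (measurable with respect to the completion of $\mu$) such that $D_j\cap N_G(x)\neq\varnothing$ for every (not merely $\mu$-almost every) $x\in X$ and every $j\in\mathbb{N}$. *)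

theory Defs
  imports "HOL-Probability.Probability"
begin

definition standard_borel_space :: "'a measure \<Rightarrow> bool" where
  "standard_borel_space M \<longleftrightarrow>
    (\<exists>T. topspace T = space M \<and> completely_metrizable_space T \<and> second_countable T \<and>
         sets M = sigma_sets (space M) {U. openin T U})"

definition borel_probability_space :: "'a measure \<Rightarrow> bool" where
  "borel_probability_space M \<longleftrightarrow> standard_borel_space M \<and> prob_space M"

text \<open>The vertex set is the space of the measure. An element of the product sigma-algebra is
  automatically a subset of the square of the vertex set, and for a standard Borel space the
  product sigma-algebra consists of the Borel subsets of that square.\<close>

definition borel_graph :: "'a measure \<Rightarrow> ('a \<times> 'a) set \<Rightarrow> bool" where
  "borel_graph M G \<longleftrightarrow> G \<in> sets (M \<Otimes>\<^sub>M M)"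

definition out_nbhd :: "'a measure \<Rightarrow> ('a \<times> 'a) set \<Rightarrow> 'a \<Rightarrow> 'a set" where
  "out_nbhd M G x = {y \<in> space M. (x, y) \<in> G}"

definition in_nbhd :: "'a measure \<Rightarrow> ('a \<times> 'a) set \<Rightarrow> 'a \<Rightarrow> 'a set" where
  "in_nbhd M G x = {y \<in> space M. (y, x) \<in> G}"

definition out_degree_aleph0_regular :: "'a measure \<Rightarrow> ('a \<times> 'a) set \<Rightarrow> bool" where
  "out_degree_aleph0_regular M G \<longleftrightarrow> (\<forall>x\<in>space M. out_nbhd M G x \<approx> (UNIV :: nat set))"

definition countable_in_degrees :: "'a measure \<Rightarrow> ('a \<times> 'a) set \<Rightarrow> bool" where
  "countable_in_degrees M G \<longleftrightarrow> (\<forall>x\<in>space M. countable (in_nbhd M G x))"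

text \<open>The sets need not cover the vertex set, and every vertex is required to have an
  out-neighbour in every set, with no exceptional null set.\<close>

definition measurable_domatic_aleph0_partition ::
  "'a measure \<Rightarrow> ('a \<times> 'a) set \<Rightarrow> (nat \<Rightarrow> 'a set) \<Rightarrow> bool" where
  "measurable_domatic_aleph0_partition M G D \<longleftrightarrow>
    (\<forall>j. D j \<in> sets (completion M)) \<and>
    disjoint_family D \<and>
    (\<forall>x\<in>space M. \<forall>j. D j \<inter> out_nbhd M G x \<noteq> {})"

end

theory Submission
  imports Defs
begin

text \<open>
  A set in the product sigma-algebra with countable sections is, off a null set, covered by
  countably many graphs of measurable functions: otherwise a Cantor scheme, kept positive over
  a decreasing sequence of closed sets of base points, yields a single point with an uncountable
  section. Pushing the measure forward along such functions for the symmetrized graph, again and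
  again, and mixing the results gives a measure that dominates the given one and for which the
  saturation of a null set is null. For it, a random choice of cells of a fine finite partition
  gives disjoint Borel sets such that almost every vertex sees each of them. The exceptional
  vertices lie in a null set which is a union of connected components; these are countable, so
  on that set the classes can be chosen greedily.
\<close>

section \<open>Borel sets as projections of closed sets\<close>

text \<open>The random sets work only almost everywhere, whereas every vertex must see every class.
  Changing them on an arbitrary null set would disturb vertices outside it, since out-neighbourhoods
  may cross its border; hence the demand for a null set closed under adjacency in both directions.
  This is where countable in-degrees enter: the symmetrized graph still has countable sections, so
  the measure can be pushed along backward edges as well, and components are countable. The Cantor
  scheme obtains its points as limits, which needs a closed set. A Borel set is therefore written as
  the projection of a closed set with an extra coordinate in
  \<open>nat \<Rightarrow> nat discrete\<close>, the Baire space. A point may then have uncountably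
  many witnesses, so the functions have to cover projected values and not points of the closed set;
  this is the role of the map \<open>\<pi>\<close>.\<close>

definition closed_projection :: "'a::topological_space set \<Rightarrow> bool" where
  "closed_projection S \<longleftrightarrow> (\<exists>F::('a \<times> (nat \<Rightarrow> nat discrete)) set. closed F \<and> S = fst ` F)"

lemma closed_projection_closed: "closed S \<Longrightarrow> closed_projection S"
  unfolding closed_projection_def
  by (intro exI[of _ "S \<times> UNIV"]) (auto intro: closed_Times)

text \<open>Coordinate 0 of the witness names a member of the union, and the shifted sequence
  witnesses membership there. Demanding for every \<open>n\<close> that coordinate 0 differs from
  \<open>n\<close> or the shift lies in \<open>F n\<close> gives a closed set, because the first
  alternative is clopen.\<close>

lemma closed_projection_UN:
  fixes S :: "nat \<Rightarrow> 'a::topological_space set"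
  assumes "\<And>n. closed_projection (S n)"
  shows "closed_projection (\<Union>n. S n)"
proof -
  obtain F :: "nat \<Rightarrow> ('a \<times> (nat \<Rightarrow> nat discrete)) set"
    where F: "\<And>n. closed (F n)" "\<And>n. S n = fst ` F n"
    using assms unfolding closed_projection_def by metis
  define E where "E = (\<Inter>n. {p. snd p 0 \<noteq> discrete n} \<union> (\<lambda>p. (fst p, \<lambda>k. snd p (Suc k))) -` F n)"
  have "closed {p::'a \<times> (nat \<Rightarrow> nat discrete). snd p 0 \<noteq> discrete n}" for n
  proof -
    have "open ((\<lambda>p::'a \<times> (nat \<Rightarrow> nat discrete). snd p 0) -` {discrete n})"
      by (intro open_vimage open_discrete continuous_intros
          continuous_on_coordinatewise_then_product continuous_on_product_then_coordinatewise)
    then show ?thesis by (simp add: closed_def vimage_def Compl_eq)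
  qed
  moreover have "closed ((\<lambda>p::'a \<times> (nat \<Rightarrow> nat discrete). (fst p, \<lambda>k. snd p (Suc k))) -` F n)" for n
    by (intro closed_vimage F continuous_intros continuous_on_coordinatewise_then_product
          continuous_on_product_then_coordinatewise)
  ultimately have "closed E"
    unfolding E_def by (intro closed_INT ballI closed_Un)
  moreover have "(\<Union>n. S n) = fst ` E"
  proof (intro set_eqI iffI)
    fix x assume "x \<in> (\<Union>n. S n)"
    then obtain n z where "(x, z) \<in> F n" using F(2) by force
    then have "(x, case_nat (discrete n) z) \<in> E"
      by (auto simp: E_def discrete_inject)
    then show "x \<in> fst ` E" by force
  next
    fix x assume "x \<in> fst ` E"
    then obtain z where z: "(x, z) \<in> E" by force
    then have "(x, \<lambda>k. z (Suc k)) \<in> F (of_discrete (z 0))"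
      by (auto simp: E_def of_discrete_inverse)
    then show "x \<in> (\<Union>n. S n)" using F(2) by force
  qed
  ultimately show ?thesis unfolding closed_projection_def by blast
qed

text \<open>One sequence codes a witness for every \<open>n\<close> at once:
  \<open>prod_encode\<close> splits the coordinates into infinitely many columns, one for each
  set.\<close>

lemma closed_projection_INT:
  fixes S :: "nat \<Rightarrow> 'a::topological_space set"
  assumes "\<And>n. closed_projection (S n)"
  shows "closed_projection (\<Inter>n. S n)"
proof -
  obtain F :: "nat \<Rightarrow> ('a \<times> (nat \<Rightarrow> nat discrete)) set"
    where F: "\<And>n. closed (F n)" "\<And>n. S n = fst ` F n"
    using assms unfolding closed_projection_def by metis
  define E where "E = (\<Inter>n. (\<lambda>p. (fst p, \<lambda>k. snd p (prod_encode (n, k)))) -` F n)"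
  have "closed ((\<lambda>p::'a \<times> (nat \<Rightarrow> nat discrete). (fst p, \<lambda>k. snd p (prod_encode (n, k)))) -` F n)" for n
    by (intro closed_vimage F continuous_intros continuous_on_coordinatewise_then_product
          continuous_on_product_then_coordinatewise)
  then have "closed E"
    unfolding E_def by (intro closed_INT ballI)
  moreover have "(\<Inter>n. S n) = fst ` E"
  proof (intro set_eqI iffI)
    fix x assume "x \<in> (\<Inter>n. S n)"
    then have "\<forall>n. \<exists>z. (x, z) \<in> F n" using F(2) by force
    then obtain z where "\<And>n. (x, z n) \<in> F n" by metis
    then have "(x, \<lambda>k. z (fst (prod_decode k)) (snd (prod_decode k))) \<in> E"
      by (auto simp: E_def)
    then show "x \<in> fst ` E" by force
  next
    fix x assume "x \<in> fst ` E"
    then show "x \<in> (\<Inter>n. S n)" using F(2) by (force simp: E_def)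
  qed
  ultimately show ?thesis unfolding closed_projection_def by blast
qed

lemma closed_projection_open:
  fixes S :: "'a::metric_space set"
  assumes "open S"
  shows "closed_projection S"
proof -
  obtain C :: "nat \<Rightarrow> 'a set" where "\<And>n. closed (C n)" "\<Union> (range C) = S"
    using open_imp_fsigma_in[OF metrizable_space_euclidean, of S] assms
    by (auto simp: fsigma_in_ascending)
  then show ?thesis using closed_projection_UN[of C] closed_projection_closed by blast
qed

lemma borel_closed_projection:
  fixes S :: "'a::metric_space set"
  assumes "S \<in> sets borel"
  shows "closed_projection S"
proof -
  have "S \<in> sigma_sets UNIV {S. open S}"
    using assms by (simp add: borel_def)
  \<comment> \<open>The class is not visibly closed under complements, so the induction carries a
    set together with its complement; unions and intersections then trade places.\<close>
  then have "closed_projection S \<and> closed_projection (- S)"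
  proof induction
    case (Basic a)
    then show ?case by (auto intro: closed_projection_open closed_projection_closed)
  next
    case Empty
    then show ?case by (simp add: closed_projection_closed)
  next
    case (Compl a)
    then show ?case by (simp add: Compl_eq_Diff_UNIV Diff_Diff_Int)
  next
    case (Union a)
    then show ?case by (simp add: closed_projection_UN closed_projection_INT)
  qed
  then show ?thesis ..
qed

section \<open>Sets with countable sections\<close>

text \<open>Countably many members with measures tending to the supremum \<open>s\<close> have a
  union \<open>T\<close> of measure at least \<open>s\<close>. A member reaching outside
  \<open>T\<close> in positive measure would, joined to \<open>T\<close>, exceed
  \<open>s\<close>.\<close>

lemma (in finite_measure) exhaustion:
  assumes \<A>: "\<A> \<subseteq> sets M" "\<A> \<noteq> {}"
    and UN: "\<And>A :: nat \<Rightarrow> 'a set. (\<And>n. A n \<in> \<A>) \<Longrightarrow> (\<Union>n. A n) \<in> \<A>"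
  shows "\<exists>A\<in>\<A>. \<forall>B\<in>\<A>. B - A \<in> null_sets M"
proof -
  define s where "s = Sup (measure M ` \<A>)"
  have bdd: "bdd_above (measure M ` \<A>)"
    by (rule bdd_aboveI[of _ "measure M (space M)"]) (auto intro: bounded_measure)
  have "\<exists>A\<in>\<A>. s - 1 / Suc n < measure M A" for n
    using less_cSupD[of "measure M ` \<A>" "s - 1 / Suc n"] \<A>(2) by (auto simp: s_def)
  then obtain A where A: "\<And>n. A n \<in> \<A>" "\<And>n. s - 1 / Suc n < measure M (A n)" by metis
  define T where "T = (\<Union>n. A n)"
  have T: "T \<in> \<A>" unfolding T_def using UN A by blast
  then have [measurable]: "T \<in> sets M" using \<A> by blast
  have "s - 1 / Suc n < measure M T" for n
  proof -
    have "measure M (A n) \<le> measure M T"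
      using A T \<A> by (intro finite_measure_mono) (auto simp: T_def)
    then show ?thesis using A(2)[of n] by simp
  qed
  then have bound: "s < measure M T + 1 / Suc n" for n
    by (simp add: algebra_simps)
  have "s \<le> measure M T"
  proof (rule field_le_epsilon)
    fix e :: real assume "0 < e"
    then obtain n where "1 / Suc n < e" using nat_approx_posE by blast
    then show "s \<le> measure M T + e" using bound[of n] by linarith
  qed
  moreover have "B - T \<in> null_sets M" if B: "B \<in> \<A>" for B
  proof -
    have [measurable]: "B \<in> sets M" using B \<A> by blast
    have "B \<union> T = (\<Union>n::nat. if n = 0 then B else T)" by (force split: if_splits)
    then have "B \<union> T \<in> \<A>" using UN[of "\<lambda>n. if n = 0 then B else T"] B T by auto
    then have "measure M (B \<union> T) \<le> s"
      unfolding s_def by (intro cSup_upper bdd) auto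
    moreover have "measure M (B \<union> T) = measure M T + measure M (B - T)"
      using finite_measure_Union'[of T B] by (simp add: Un_commute)
    ultimately have "measure M (B - T) = 0"
      using \<open>s \<le> measure M T\<close> measure_nonneg[of M "B - T"] by linarith
    then show ?thesis by (auto simp: null_sets_def emeasure_eq_measure)
  qed
  ultimately show ?thesis using T by blast
qed

lemma borel_measurable_limit_extension:
  fixes g :: "nat \<Rightarrow> 'a \<Rightarrow> 'b::{complete_space, second_countable_topology}"
  assumes [measurable]: "\<And>n. g n \<in> borel_measurable M"
  shows "\<exists>h\<in>borel_measurable M. \<forall>x\<in>space M. \<forall>p. (\<lambda>n. g n x) \<longlonglongrightarrow> p \<longrightarrow> h x = p"
proof -
  \<comment> \<open>Where the sequence is not Cauchy it is replaced by a constant, so that the limit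
    exists everywhere; where it converges, nothing changes.\<close>
  define h where "h x = lim (\<lambda>n. if Cauchy (\<lambda>n. g n x) then g n x else undefined)" for x
  have conv: "convergent (\<lambda>n. if Cauchy (\<lambda>n. g n x) then g n x else undefined)" for x
    by (cases "Cauchy (\<lambda>n. g n x)") (auto simp: Cauchy_convergent_iff convergent_const)
  have "h \<in> borel_measurable M"
    by (rule borel_measurable_LIMSEQ_metric[of "\<lambda>n x. if Cauchy (\<lambda>n. g n x) then g n x else undefined"])
       (use conv in \<open>auto simp: h_def convergent_LIMSEQ_iff\<close>)
  moreover have "h x = p" if "(\<lambda>n. g n x) \<longlonglongrightarrow> p" for x p
    using that LIMSEQ_imp_Cauchy[OF that] limI[OF that] by (simp add: h_def)
  ultimately show ?thesis by blast
qed

section \<open>Strips that no countable family of measurable functions covers\<close>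

locale fibre_cover = finite_measure M
  for M :: "'a::{complete_space, second_countable_topology} measure" +
  fixes F :: "('a \<times> 'w::{complete_space, second_countable_topology}) set"
    and \<pi> :: "'w \<Rightarrow> 'b::{complete_space, second_countable_topology}"
  assumes sets_M: "sets M = sets borel"
    and cont: "continuous_on UNIV \<pi>"
begin

lemma space_M [simp]: "space M = UNIV"
  using sets_eq_imp_space_eq[OF sets_M] by simp

definition covered :: "'a set \<Rightarrow> 'w set \<Rightarrow> bool" where
  "covered A V \<longleftrightarrow> (\<exists>\<Phi>. countable \<Phi> \<and> \<Phi> \<subseteq> borel_measurable M \<and>
    (AE x in M. x \<in> A \<longrightarrow> (\<forall>w\<in>V. (x, w) \<in> F \<longrightarrow> (\<exists>f\<in>\<Phi>. \<pi> w = f x))))"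

lemma covered_UN:
  assumes "\<And>n::nat. covered (A n) V"
  shows "covered (\<Union>n. A n) V"
proof -
  have "\<forall>n. \<exists>\<Phi>. countable \<Phi> \<and> \<Phi> \<subseteq> borel_measurable M \<and>
    (AE x in M. x \<in> A n \<longrightarrow> (\<forall>w\<in>V. (x, w) \<in> F \<longrightarrow> (\<exists>f\<in>\<Phi>. \<pi> w = f x)))"
    using assms by (simp add: covered_def)
  from choice[OF this] obtain \<Phi> where \<Phi>: "\<forall>n. countable (\<Phi> n) \<and> \<Phi> n \<subseteq> borel_measurable M \<and>
    (AE x in M. x \<in> A n \<longrightarrow> (\<forall>w\<in>V. (x, w) \<in> F \<longrightarrow> (\<exists>f\<in>\<Phi> n. \<pi> w = f x)))"
    by blast
  have "AE x in M. \<forall>n. x \<in> A n \<longrightarrow> (\<forall>w\<in>V. (x, w) \<in> F \<longrightarrow> (\<exists>f\<in>\<Phi> n. \<pi> w = f x))"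
    using \<Phi> by (simp add: AE_all_countable)
  then have "AE x in M. x \<in> (\<Union>n. A n) \<longrightarrow>
      (\<forall>w\<in>V. (x, w) \<in> F \<longrightarrow> (\<exists>f\<in>(\<Union>n. \<Phi> n). \<pi> w = f x))"
    by eventually_elim blast
  then show ?thesis
    unfolding covered_def using \<Phi>
    by (intro exI[of _ "\<Union>n. \<Phi> n"] conjI countable_UN UN_least) auto
qed

text \<open>The base points over which no positive part of the strip over \<open>V\<close> is covered: the complement
  of a covered set that is maximal up to null sets.\<close>

definition core :: "'w set \<Rightarrow> 'a set" where
  "core V = - (SOME A. A \<in> sets M \<and> covered A V \<and>
    (\<forall>B\<in>sets M. covered B V \<longrightarrow> B - A \<in> null_sets M))"

lemma core:
  shows sets_core [measurable]: "core V \<in> sets M"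
    and covered_Compl_core: "covered (- core V) V"
    and null_core: "B \<in> sets M \<Longrightarrow> covered B V \<Longrightarrow> B \<inter> core V \<in> null_sets M"
proof -
  define A where "A = (SOME A. A \<in> sets M \<and> covered A V \<and>
    (\<forall>B\<in>sets M. covered B V \<longrightarrow> B - A \<in> null_sets M))"
  have "{} \<in> {A \<in> sets M. covered A V}" by (auto simp: covered_def intro: exI[of _ "{}"])
  then have "\<exists>A\<in>{A \<in> sets M. covered A V}. \<forall>B\<in>{A \<in> sets M. covered A V}. B - A \<in> null_sets M"
    by (intro exhaustion) (auto intro: covered_UN)
  then have "\<exists>A. A \<in> sets M \<and> covered A V \<and> (\<forall>B\<in>sets M. covered B V \<longrightarrow> B - A \<in> null_sets M)"
    by blast
  from someI_ex[OF this, folded A_def]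
  have *: "A \<in> sets M" "covered A V" "\<And>B. B \<in> sets M \<Longrightarrow> covered B V \<Longrightarrow> B - A \<in> null_sets M"
    by auto
  have c: "core V = - A" by (simp add: core_def A_def)
  show "core V \<in> sets M" using sets.compl_sets[OF *(1)] by (simp add: c Compl_eq_Diff_UNIV)
  show "covered (- core V) V" using * by (simp add: c)
  show "B \<in> sets M \<Longrightarrow> covered B V \<Longrightarrow> B \<inter> core V \<in> null_sets M"
    using *(3)[of B] by (simp add: c Diff_eq)
qed

text \<open>The empty family covers the strip over base points where it is empty, so a positive part
  of the core cannot consist of such points. This supplies the points of the nested sets in the
  Cantor scheme.\<close>

lemma core_fibre_nonempty:
  assumes "A \<in> sets M" "A \<subseteq> core V" "0 < emeasure M A"
  shows "\<exists>x\<in>A. \<exists>w\<in>V. (x, w) \<in> F"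
proof (rule ccontr)
  assume "\<not> ?thesis"
  then have "covered A V"
    unfolding covered_def by (intro exI[of _ "{}"]) auto
  from null_core[OF assms(1) this] have "A \<in> null_sets M" using assms(2) by (simp add: Int_absorb2)
  then show False using assms(3) by auto
qed

text \<open>Taking all sets from one fixed countable base allows almost-everywhere statements about
  all pairs of them. Closures inside \<open>V\<close> and radius at most \<open>\<epsilon>\<close>
  are what nested intersections in a complete space need.\<close>

definition basic_sets :: "real \<Rightarrow> 'w set \<Rightarrow> 'w set set" where
  "basic_sets \<epsilon> V = {C \<in> (SOME \<B>. countable \<B> \<and> topological_basis \<B>).
     closure C \<subseteq> V \<and> (\<exists>c. C \<subseteq> cball c \<epsilon>)}"

lemma basic_sets:
  shows countable_basic_sets: "countable (basic_sets \<epsilon> V)"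
    and basic_setsD: "C \<in> basic_sets \<epsilon> V \<Longrightarrow> open C \<and> closure C \<subseteq> V \<and> (\<exists>c. C \<subseteq> cball c \<epsilon>)"
    and basic_sets_nhd: "open V \<Longrightarrow> open W \<Longrightarrow> w \<in> V \<Longrightarrow> w \<in> W \<Longrightarrow> 0 < \<epsilon> \<Longrightarrow> \<exists>C\<in>basic_sets \<epsilon> V. w \<in> C \<and> C \<subseteq> W"
proof -
  define \<B> :: "'w set set" where "\<B> = (SOME \<B>. countable \<B> \<and> topological_basis \<B>)"
  have \<B>: "countable \<B>" "topological_basis \<B>"
    using someI_ex[OF ex_countable_basis[where 'a='w]] by (auto simp: \<B>_def)
  have eq: "basic_sets \<epsilon> V = {C \<in> \<B>. closure C \<subseteq> V \<and> (\<exists>c. C \<subseteq> cball c \<epsilon>)}" for \<epsilon> V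
    by (simp add: basic_sets_def \<B>_def)
  show "countable (basic_sets \<epsilon> V)" unfolding eq by (rule countable_subset[OF _ \<B>(1)]) auto
  show "C \<in> basic_sets \<epsilon> V \<Longrightarrow> open C \<and> closure C \<subseteq> V \<and> (\<exists>c. C \<subseteq> cball c \<epsilon>)"
    using topological_basis_open[OF \<B>(2)] by (auto simp: eq)
  assume VW: "open V" "open W" "w \<in> V" "w \<in> W" "0 < \<epsilon>"
  then obtain r where r: "r > 0" "ball w r \<subseteq> V \<inter> W \<inter> ball w \<epsilon>"
    using openE[of "V \<inter> W \<inter> ball w \<epsilon>" w] by auto
  obtain C where C: "C \<in> \<B>" "w \<in> C" "C \<subseteq> ball w (r / 2)"
    using topological_basisE[OF \<B>(2), of "ball w (r / 2)" w] r(1) by auto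
  have "closure C \<subseteq> cball w (r / 2)"
    using C(3) by (meson ball_subset_cball closed_cball closure_minimal order_trans)
  also have "\<dots> \<subseteq> ball w r" using r(1) by auto
  finally have "closure C \<subseteq> ball w r" .
  then have "closure C \<subseteq> V" "C \<subseteq> W" "C \<subseteq> cball w \<epsilon>"
    using r(2) closure_subset[of C] ball_subset_cball[of w \<epsilon>] by blast+
  then show "\<exists>C\<in>basic_sets \<epsilon> V. w \<in> C \<and> C \<subseteq> W" using C by (auto simp: eq)
qed

text \<open>If no pair separates, then for almost every \<open>x\<close> in \<open>A\<close> any two
  basic sets whose cores contain \<open>x\<close> have meeting images. A point \<open>w\<close> over
  \<open>x\<close> may have a basic neighbourhood whose core omits \<open>x\<close>; then the
  functions of that neighbourhood handle it. Otherwise all its basic neighbourhoods have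
  \<open>x\<close> in their cores; meeting images leave a single possible value
  \<open>\<pi> w\<close>, which one measurable function computes. Either way \<open>A\<close> would
  be covered, contrary to lying in the core.\<close>

lemma core_split:
  assumes A: "A \<in> sets M" "A \<subseteq> core V" "0 < emeasure M A" and V: "open V" and \<epsilon>: "0 < \<epsilon>"
  shows "\<exists>C\<in>basic_sets \<epsilon> V. \<exists>D\<in>basic_sets \<epsilon> V. \<pi> ` C \<inter> \<pi> ` D = {} \<and>
    0 < emeasure M (A \<inter> core C \<inter> core D)"
proof (rule ccontr)
  let ?\<C> = "basic_sets \<epsilon> V"
  assume "\<not> ?thesis"
  then have "AE x in M. x \<in> A \<and> \<pi> ` C \<inter> \<pi> ` D = {} \<longrightarrow> \<not> (x \<in> core C \<and> x \<in> core D)"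
    if "C \<in> ?\<C>" "D \<in> ?\<C>" for C D
    using that A(1)
    by (cases "\<pi> ` C \<inter> \<pi> ` D = {}") (auto intro!: AE_I[of _ _ "A \<inter> core C \<inter> core D"])
  then have sep: "AE x in M. \<forall>C\<in>?\<C>. \<forall>D\<in>?\<C>. x \<in> A \<and> \<pi> ` C \<inter> \<pi> ` D = {} \<longrightarrow> \<not> (x \<in> core C \<and> x \<in> core D)"
    by (simp add: AE_ball_countable countable_basic_sets)
  have "\<forall>C. \<exists>\<Phi>. countable \<Phi> \<and> \<Phi> \<subseteq> borel_measurable M \<and>
    (AE x in M. x \<in> - core C \<longrightarrow> (\<forall>w\<in>C. (x, w) \<in> F \<longrightarrow> (\<exists>f\<in>\<Phi>. \<pi> w = f x)))"
    using covered_Compl_core unfolding covered_def by blast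
  from choice[OF this] obtain \<Phi> where \<Phi>: "\<forall>C. countable (\<Phi> C) \<and> \<Phi> C \<subseteq> borel_measurable M \<and>
    (AE x in M. x \<in> - core C \<longrightarrow> (\<forall>w\<in>C. (x, w) \<in> F \<longrightarrow> (\<exists>f\<in>\<Phi> C. \<pi> w = f x)))" by blast
  then have cov: "AE x in M. \<forall>C\<in>?\<C>. x \<in> - core C \<longrightarrow> (\<forall>w\<in>C. (x, w) \<in> F \<longrightarrow> (\<exists>f\<in>\<Phi> C. \<pi> w = f x))"
    by (simp add: AE_ball_countable countable_basic_sets)
  obtain X :: "'b set" where X: "countable X" "\<And>Y. open Y \<Longrightarrow> Y \<noteq> {} \<Longrightarrow> \<exists>d\<in>X. d \<in> Y"
    using countable_dense_setE by blast
  define d where "d = from_nat_into X"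
  have d: "\<exists>k. d k \<in> Y" if "open Y" "Y \<noteq> {}" for Y
    using X(2)[OF that] from_nat_into_surj[OF X(1)] by (metis d_def)
  define Q where "Q n k x \<longleftrightarrow> (\<exists>C\<in>?\<C>. x \<in> core C \<and> \<pi> ` C \<subseteq> ball (d k) (1 / Suc n))" for n k :: nat and x
  have [measurable]: "Measurable.pred M (Q n k)" for n k
  proof -
    have "{x. Q n k x} = (\<Union>C\<in>{C \<in> ?\<C>. \<pi> ` C \<subseteq> ball (d k) (1 / Suc n)}. core C)"
      by (auto simp: Q_def)
    also have "\<dots> \<in> sets M"
      by (intro sets.countable_UN' sets_core countable_subset[OF _ countable_basic_sets[of \<epsilon> V]]) auto
    finally show ?thesis by (simp add: pred_def)
  qed
  \<comment> \<open>If no two of the basic sets separate, those whose core contains \<open>x\<close> shrink to a single value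
    of \<open>\<pi>\<close>, and \<open>g n x\<close> approximates it.\<close>
  define g where "g n x = d (LEAST k. Q n k x)" for n x
  have [measurable]: "g n \<in> borel_measurable M" for n
    unfolding g_def by measurable
  obtain h where h: "h \<in> borel_measurable M"
    "\<And>x p. (\<lambda>n. g n x) \<longlonglongrightarrow> p \<Longrightarrow> h x = p"
    using borel_measurable_limit_extension[of g M] by auto
  from sep cov have "AE x in M. x \<in> A \<longrightarrow> (\<forall>w\<in>V. (x, w) \<in> F \<longrightarrow> (\<exists>f\<in>insert h (\<Union>C\<in>?\<C>. \<Phi> C). \<pi> w = f x))"
  proof (eventually_elim, intro impI ballI)
    fix x w
    assume sep: "\<forall>C\<in>?\<C>. \<forall>D\<in>?\<C>. x \<in> A \<and> \<pi> ` C \<inter> \<pi> ` D = {} \<longrightarrow> \<not> (x \<in> core C \<and> x \<in> core D)"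
      and cov: "\<forall>C\<in>?\<C>. x \<in> - core C \<longrightarrow> (\<forall>w\<in>C. (x, w) \<in> F \<longrightarrow> (\<exists>f\<in>\<Phi> C. \<pi> w = f x))"
      and x: "x \<in> A" and w: "w \<in> V" and F: "(x, w) \<in> F"
    show "\<exists>f\<in>insert h (\<Union>C\<in>?\<C>. \<Phi> C). \<pi> w = f x"
    proof (cases "\<exists>C\<in>?\<C>. w \<in> C \<and> x \<notin> core C")
      case True
      then show ?thesis using cov F by blast
    next
      case False
      have nhd: "\<exists>C\<in>?\<C>. w \<in> C \<and> x \<in> core C \<and> \<pi> ` C \<subseteq> Y" if "open Y" "\<pi> w \<in> Y" for Y
        using basic_sets_nhd[OF V open_vimage[OF that(1) cont] w _ \<epsilon>] that(2) False by blast
      have "dist (g n x) (\<pi> w) \<le> 1 / Suc n" for n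
      proof -
        have "ball (\<pi> w) (1 / Suc n) \<noteq> {}" by simp
        then obtain k where "d k \<in> ball (\<pi> w) (1 / Suc n)" using d[OF open_ball] by blast
        then obtain C where "C \<in> ?\<C>" "x \<in> core C" "\<pi> ` C \<subseteq> ball (d k) (1 / Suc n)"
          using nhd[of "ball (d k) (1 / Suc n)"] by (auto simp: dist_commute)
        then have "Q n k x" by (auto simp: Q_def)
        then have "Q n (LEAST k. Q n k x) x" by (rule LeastI)
        then obtain C where C: "C \<in> ?\<C>" "x \<in> core C" "\<pi> ` C \<subseteq> ball (g n x) (1 / Suc n)"
          unfolding Q_def g_def by blast
        show ?thesis
        proof (rule field_le_epsilon)
          fix e :: real assume "0 < e"
          then obtain D where D: "D \<in> ?\<C>" "x \<in> core D" "\<pi> ` D \<subseteq> ball (\<pi> w) e"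
            using nhd[of "ball (\<pi> w) e"] by auto
          \<comment> \<open>The image of \<open>C\<close> lies within \<open>1 / Suc n\<close> of
            \<open>g n x\<close> and that of \<open>D\<close> within \<open>e\<close> of
            \<open>\<pi> w\<close>; a common point links the two centres.\<close>
          have "\<pi> ` C \<inter> \<pi> ` D \<noteq> {}" using sep x C D by blast
          then obtain p where "p \<in> \<pi> ` C" "p \<in> \<pi> ` D" by blast
          then have "dist (g n x) p < 1 / Suc n" "dist (\<pi> w) p < e" using C(3) D(3) by auto
          then show "dist (g n x) (\<pi> w) \<le> 1 / Suc n + e"
            using dist_triangle2[of "g n x" "\<pi> w" p] by simp
        qed
      qed
      then have "(\<lambda>n. g n x) \<longlonglongrightarrow> \<pi> w"
        unfolding tendsto_dist_iff[of "\<lambda>n. g n x"]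
        by (intro real_tendsto_sandwich[OF _ _ tendsto_const LIMSEQ_inverse_real_of_nat])
           (simp_all add: inverse_eq_divide del: of_nat_Suc)
      then show ?thesis using h(2) by auto
    qed
  qed
  then have "covered A V"
    unfolding covered_def using \<Phi> h(1)
    by (intro exI[of _ "insert h (\<Union>C\<in>?\<C>. \<Phi> C)"]) (auto simp: countable_basic_sets)
  from null_core[OF A(1) this] have "A \<in> null_sets M" using A(2) by (simp add: Int_absorb2)
  then show False using A(3) by auto
qed

definition splitting :: "real \<Rightarrow> 'a set \<Rightarrow> 'w set \<Rightarrow> (bool \<Rightarrow> 'w set) \<Rightarrow> bool" where
  "splitting \<epsilon> A V W \<longleftrightarrow> (\<forall>b. open (W b) \<and> closure (W b) \<subseteq> V \<and> (\<exists>c. W b \<subseteq> cball c \<epsilon>) \<and> A \<subseteq> core (W b))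
     \<and> \<pi> ` W False \<inter> \<pi> ` W True = {}"

text \<open>The finitely many nodes are treated one after the other. Shrinking the base set for a
  new node keeps the earlier splittings, because they mention it only through inclusions in
  cores.\<close>

lemma splitting_finite:
  assumes "finite S" "A \<in> sets M" "0 < emeasure M A" "0 < \<epsilon>"
    and "\<And>s. s \<in> S \<Longrightarrow> open (V s) \<and> A \<subseteq> core (V s)"
  shows "\<exists>B\<in>sets M. B \<subseteq> A \<and> 0 < emeasure M B \<and> (\<exists>W. \<forall>s\<in>S. splitting \<epsilon> B (V s) (W s))"
  using assms
proof (induction S)
  case empty
  then show ?case by auto
next
  case (insert s S)
  then obtain B W where B: "B \<in> sets M" "B \<subseteq> A" "0 < emeasure M B"
    "\<forall>t\<in>S. splitting \<epsilon> B (V t) (W t)" by auto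
  then have "B \<subseteq> core (V s)" "open (V s)" using insert.prems by auto
  with core_split[OF B(1) _ B(3) _ \<open>0 < \<epsilon>\<close>] obtain C D
    where CD: "C \<in> basic_sets \<epsilon> (V s)" "D \<in> basic_sets \<epsilon> (V s)" "\<pi> ` C \<inter> \<pi> ` D = {}"
      "0 < emeasure M (B \<inter> core C \<inter> core D)" by blast
  define W' where "W' = W(s := (\<lambda>b. if b then D else C))"
  have "splitting \<epsilon> (B \<inter> core C \<inter> core D) (V t) (W' t)" if "t \<in> insert s S" for t
  proof (cases "t = s")
    case True
    then show ?thesis using basic_setsD[OF CD(1)] basic_setsD[OF CD(2)] CD(3)
      by (auto simp: splitting_def W'_def)
  next
    case False
    then have "splitting \<epsilon> B (V t) (W t)" using that B(4) by blast
    then show ?thesis using False by (auto simp: splitting_def W'_def)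
  qed
  then show ?case using B CD(4)
    by (intro bexI[of _ "B \<inter> core C \<inter> core D"]) (auto intro!: exI[of _ W'])
qed

text \<open>Balls of radius \<open>\<epsilon>\<close> about a countable dense set cover
  \<open>A\<close>, so one of them keeps positive measure, and inner regularity finds a compact set
  inside. Repeated with radii tending to 0, this pins the base point down.\<close>

lemma closed_small_subset:
  assumes A: "A \<in> sets M" "0 < emeasure M A" and \<epsilon>: "0 < \<epsilon>"
  shows "\<exists>K\<subseteq>A. closed K \<and> 0 < emeasure M K \<and> (\<exists>c. K \<subseteq> cball c \<epsilon>)"
proof -
  obtain X :: "'a set" where X: "countable X" "\<And>Y. open Y \<Longrightarrow> Y \<noteq> {} \<Longrightarrow> \<exists>d\<in>X. d \<in> Y"
    using countable_dense_setE by blast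
  have [measurable]: "cball c \<epsilon> \<in> sets M" for c using sets_M by simp
  have "\<exists>c\<in>X. 0 < emeasure M (A \<inter> cball c \<epsilon>)"
  proof (rule ccontr)
    assume "\<not> ?thesis"
    then have "(\<Union>c\<in>X. A \<inter> cball c \<epsilon>) \<in> null_sets M"
      using A(1) X(1) by (intro null_sets_UN') auto
    moreover have "A \<subseteq> (\<Union>c\<in>X. A \<inter> cball c \<epsilon>)"
    proof
      fix x assume "x \<in> A"
      then show "x \<in> (\<Union>c\<in>X. A \<inter> cball c \<epsilon>)"
        using X(2)[of "ball x \<epsilon>"] \<epsilon> by (force simp: dist_commute)
    qed
    ultimately have "A \<in> null_sets M" using A(1) null_sets_subset by blast
    then show False using A(2) by auto
  qed
  then obtain c where c: "0 < emeasure M (A \<inter> cball c \<epsilon>)" by blast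
  have "emeasure M (A \<inter> cball c \<epsilon>) = (SUP K\<in>{K. K \<subseteq> A \<inter> cball c \<epsilon> \<and> compact K}. emeasure M K)"
    using A(1) sets_M by (intro inner_regular) (auto simp: emeasure_finite)
  with c obtain K where "K \<subseteq> A \<inter> cball c \<epsilon>" "compact K" "0 < emeasure M K"
    by (auto simp: less_SUP_iff)
  then show ?thesis by (intro exI[of _ K]) (auto intro: compact_imp_closed)
qed

end

section \<open>Binary branches and the Cantor scheme\<close>

primrec initial_segment :: "(nat \<Rightarrow> 'a) \<Rightarrow> nat \<Rightarrow> 'a list" where
  "initial_segment \<alpha> 0 = []"
| "initial_segment \<alpha> (Suc n) = \<alpha> n # initial_segment \<alpha> n"

lemma length_initial_segment [simp]: "length (initial_segment \<alpha> n) = n"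
  by (induction n) auto

lemma initial_segment_cong: "(\<And>k. k < n \<Longrightarrow> \<alpha> k = \<beta> k) \<Longrightarrow> initial_segment \<alpha> n = initial_segment \<beta> n"
  by (induction n) auto

lemma uncountable_nat_bool: "uncountable (UNIV :: (nat \<Rightarrow> bool) set)"
proof
  assume "countable (UNIV :: (nat \<Rightarrow> bool) set)"
  then obtain f :: "nat \<Rightarrow> nat \<Rightarrow> bool" where "UNIV = range f"
    using countable_as_injective_image uncountable_def by (metis empty_not_UNIV)
  then obtain n where "(\<lambda>k. \<not> f k k) = f n" by (metis UNIV_I imageE)
  then show False by metis
qed

lemma dist_le_cball: "x \<in> cball c r \<Longrightarrow> y \<in> cball c r \<Longrightarrow> dist x y \<le> 2 * r"
  using dist_triangle2[of x y c] by (simp add: dist_commute)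

lemma dist_prod_le: "dist p q \<le> dist (fst p) (fst q) + dist (snd p) (snd q)"
  unfolding dist_prod_def by (rule sqrt_sum_squares_le_sum) auto

context fibre_cover begin

text \<open>All nodes of a level share a single base set \<open>A n\<close>. This forces all
  branches onto the same base point, so that the uncountably many values obtained belong to one
  section; a separate base set for each node would give unrelated base points.\<close>

theorem covered_UNIV:
  assumes F: "closed F" and countable: "\<And>x. countable (\<pi> ` (F `` {x}))"
  shows "covered UNIV UNIV"
proof (rule ccontr)
  assume not_covered: "\<not> covered UNIV UNIV"
  have pos: "0 < emeasure M (core UNIV)"
  proof (rule ccontr)
    assume "\<not> ?thesis"
    then have "AE x in M. x \<notin> core UNIV"
      by (intro AE_not_in) (auto simp: null_sets_def)
    moreover obtain \<Phi> where \<Phi>: "countable \<Phi>" "\<Phi> \<subseteq> borel_measurable M"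
      "AE x in M. x \<in> - core UNIV \<longrightarrow> (\<forall>w\<in>UNIV. (x, w) \<in> F \<longrightarrow> (\<exists>f\<in>\<Phi>. \<pi> w = f x))"
      using covered_Compl_core[of UNIV] unfolding covered_def by blast
    ultimately have "AE x in M. x \<in> UNIV \<longrightarrow> (\<forall>w\<in>UNIV. (x, w) \<in> F \<longrightarrow> (\<exists>f\<in>\<Phi>. \<pi> w = f x))"
      by auto
    then have "covered UNIV UNIV" unfolding covered_def using \<Phi>(1,2) by blast
    then show False using not_covered by blast
  qed
  define P :: "nat \<Rightarrow> 'a set \<times> (bool list \<Rightarrow> 'w set) \<Rightarrow> bool" where
    "P n = (\<lambda>(A, V). closed A \<and> 0 < emeasure M A \<and> (\<exists>c. A \<subseteq> cball c (1 / Suc n)) \<and>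
      (\<forall>s. length s = n \<longrightarrow> open (V s) \<and> A \<subseteq> core (V s)))" for n
  define Q :: "nat \<Rightarrow> 'a set \<times> (bool list \<Rightarrow> 'w set) \<Rightarrow> 'a set \<times> (bool list \<Rightarrow> 'w set) \<Rightarrow> bool" where
    "Q n = (\<lambda>(A, V) (A', V'). A' \<subseteq> A \<and>
      (\<forall>s. length s = n \<longrightarrow> splitting (1 / Suc n) A' (V s) (\<lambda>b. V' (b # s))))" for n
  have "\<exists>p. P 0 p"
    using closed_small_subset[OF _ pos, of 1] by (auto simp: P_def intro!: exI[of _ "\<lambda>_. UNIV"])
  moreover have "\<exists>q. P (Suc n) q \<and> Q n p q" if P: "P n p" for n p
  proof -
    obtain A V where p: "p = (A, V)" by (cases p)
    have "closed A" "0 < emeasure M A" "\<And>s. length s = n \<Longrightarrow> open (V s) \<and> A \<subseteq> core (V s)"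
      using P by (auto simp: P_def p)
    then obtain B W where B: "B \<in> sets M" "B \<subseteq> A" "0 < emeasure M B"
      "\<And>s. length s = n \<Longrightarrow> splitting (1 / Suc n) B (V s) (W s)"
      using splitting_finite[of "{s. length s = n}" A "1 / Suc n" V]
        finite_lists_length_eq[of "UNIV :: bool set" n] sets_M by auto
    obtain K c where K: "K \<subseteq> B" "closed K" "0 < emeasure M K" "K \<subseteq> cball c (1 / Suc (Suc n))"
      using closed_small_subset[OF B(1,3), of "1 / Suc (Suc n)"] by auto
    \<comment> \<open>The newest bit is the head of a node, as in \<open>initial_segment\<close>:
      \<open>tl s\<close> is the parent and \<open>hd s\<close> selects the child.\<close>
    define V' where "V' s = W (tl s) (hd s)" for s
    have split: "splitting (1 / Suc n) K (V s) (\<lambda>b. V' (b # s))" if "length s = n" for s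
      using B(4)[OF that] K(1) by (auto simp: splitting_def V'_def)
    have "open (V' s) \<and> K \<subseteq> core (V' s)" if "length s = Suc n" for s
      using that split[of "tl s"] by (cases s) (auto simp: splitting_def)
    then have "P (Suc n) (K, V')" using K by (auto simp: P_def)
    moreover have "Q n p (K, V')" using split K(1) B(2) by (auto simp: Q_def p)
    ultimately show ?thesis by blast
  qed
  ultimately obtain f where f: "\<And>n. P n (f n) \<and> Q n (f n) (f (Suc n))"
    using dependent_nat_choice[of P Q] by blast
  define A V where "A n = fst (f n)" and "V n = snd (f n)" for n
  have A: "closed (A n)" "0 < emeasure M (A n)" "A (Suc n) \<subseteq> A n"
    and core: "length s = n \<Longrightarrow> A n \<subseteq> core (V n s)"
    and splitting: "length s = n \<Longrightarrow> splitting (1 / Suc n) (A (Suc n)) (V n s) (\<lambda>b. V (Suc n) (b # s))" for n s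
    using f[of n] by (auto simp: P_def Q_def A_def V_def split_beta)
  have small_A: "\<exists>c. A n \<subseteq> cball c (1 / Suc n)" for n
    using f[of n] by (auto simp: P_def A_def split_beta)
  have close: "x = y" if "\<And>n. x \<in> A n" "\<And>n. y \<in> A n" for x y
  proof -
    have "dist x y \<le> 0 + e" if "0 < e" for e
    proof -
      obtain n where n: "1 / Suc n < e / 2" using nat_approx_posE[of "e / 2"] \<open>0 < e\<close> by auto
      obtain c where "A n \<subseteq> cball c (1 / Suc n)" using small_A by blast
      then have "dist x y \<le> 2 * (1 / Suc n)" using dist_le_cball \<open>x \<in> A n\<close> \<open>y \<in> A n\<close> by blast
      then show ?thesis using n by simp
    qed
    then have "dist x y \<le> 0" by (rule field_le_epsilon)
    then show ?thesis by simp
  qed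
  have "\<exists>p. p \<in> F \<and> (\<forall>n. fst p \<in> A n \<and> snd p \<in> V n (initial_segment \<alpha> n))" for \<alpha>
  proof -
    let ?V = "\<lambda>n. V n (initial_segment \<alpha> n)"
    define S where "S n = F \<inter> A n \<times> closure (?V n)" for n
    have V: "closure (?V (Suc n)) \<subseteq> ?V n" "\<exists>c. ?V (Suc n) \<subseteq> cball c (1 / Suc n)" for n
      using splitting[of "initial_segment \<alpha> n" n] by (auto simp: splitting_def)
    have "closed (S n)" for n
      unfolding S_def using F A by (intro closed_Int closed_Times) auto
    moreover have "S n \<noteq> {}" for n
    proof -
      have "A n \<in> sets M" using A(1) sets_M by simp
      then obtain x w where "x \<in> A n" "w \<in> ?V n" "(x, w) \<in> F"
        using core_fibre_nonempty[OF _ core[of "initial_segment \<alpha> n" n] A(2)] by auto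
      then show ?thesis using closure_subset by (fastforce simp: S_def)
    qed
    moreover have "S n \<subseteq> S m" if "m \<le> n" for m n
    proof (rule lift_Suc_antimono_le[OF _ that])
      show "S (Suc n) \<subseteq> S n" for n
        using A(3)[of n] V(1)[of n] closure_subset[of "?V n"] by (auto simp: S_def)
    qed
    moreover have "\<exists>n. \<forall>p\<in>S n. \<forall>q\<in>S n. dist p q < e" if "0 < e" for e
    proof -
      \<comment> \<open>Base parts contribute at most \<open>2 / (n + 2)\<close> and fibre parts at
        most \<open>2 / (n + 1)\<close>, hence \<open>e / 4\<close>. The level is
        \<open>Suc n\<close> because only children carry a radius bound in the fibre; the root has
        none.\<close>
      obtain n where n: "1 / Suc n < e / 4" using nat_approx_posE[of "e / 4"] \<open>0 < e\<close> by auto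
      have le: "1 / Suc (Suc n) \<le> 1 / Suc n" by (simp add: frac_le)
      obtain c where c: "A (Suc n) \<subseteq> cball c (1 / Suc (Suc n))" using small_A by blast
      obtain d where "?V (Suc n) \<subseteq> cball d (1 / Suc n)" using V(2) by blast
      then have d: "closure (?V (Suc n)) \<subseteq> cball d (1 / Suc n)" by (simp add: closure_minimal)
      have "dist p q < e" if "p \<in> S (Suc n)" "q \<in> S (Suc n)" for p q
      proof -
        have "dist (fst p) (fst q) \<le> 2 * (1 / Suc (Suc n))"
          using that c by (intro dist_le_cball[of _ c]) (auto simp: S_def)
        moreover have "dist (snd p) (snd q) \<le> 2 * (1 / Suc n)"
          using that d by (intro dist_le_cball[of _ d]) (auto simp: S_def)
        ultimately show ?thesis using dist_prod_le[of p q] n le by linarith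
      qed
      then show ?thesis by blast
    qed
    ultimately obtain p where p: "\<And>n. p \<in> S n" using decreasing_closed_nest[of S] by metis
    \<comment> \<open>Looking one level further down puts the limit into the open set itself, not
      only into its closure.\<close>
    have "snd p \<in> ?V n" for n using p[of "Suc n"] V(1)[of n] by (auto simp: S_def)
    then show ?thesis using p by (intro exI[of _ p]) (auto simp: S_def mem_Times_iff)
  qed
  then obtain p where p: "\<And>\<alpha>. p \<alpha> \<in> F" "\<And>\<alpha> n. fst (p \<alpha>) \<in> A n"
    "\<And>\<alpha> n. snd (p \<alpha>) \<in> V n (initial_segment \<alpha> n)" by metis
  define x where "x = fst (p undefined)"
  have x: "fst (p \<alpha>) = x" for \<alpha> unfolding x_def using close p(2) by blast
  have "inj (\<lambda>\<alpha>. \<pi> (snd (p \<alpha>)))"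
  proof (rule injI, rule ccontr)
    fix \<alpha> \<beta> assume eq: "\<pi> (snd (p \<alpha>)) = \<pi> (snd (p \<beta>))" and "\<alpha> \<noteq> \<beta>"
    \<comment> \<open>Up to \<open>n\<close> the branches share a node; there they enter different
      children, whose images are disjoint.\<close>
    define n where "n = (LEAST n. \<alpha> n \<noteq> \<beta> n)"
    have n: "\<alpha> n \<noteq> \<beta> n"
      unfolding n_def by (rule LeastI_ex) (use \<open>\<alpha> \<noteq> \<beta>\<close> in auto)
    have below_n: "\<alpha> k = \<beta> k" if "k < n" for k
      using not_less_Least that unfolding n_def by blast
    define s where "s = initial_segment \<alpha> n"
    have s: "initial_segment \<beta> n = s" "length s = n"
      using initial_segment_cong[of n \<alpha> \<beta>] below_n by (auto simp: s_def)
    have mem: "\<pi> (snd (p \<alpha>)) \<in> \<pi> ` V (Suc n) (\<alpha> n # s)" "\<pi> (snd (p \<beta>)) \<in> \<pi> ` V (Suc n) (\<beta> n # s)"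
      using p(3)[of \<alpha> "Suc n"] p(3)[of \<beta> "Suc n"] s by (auto simp: s_def)
    have "\<pi> ` V (Suc n) (False # s) \<inter> \<pi> ` V (Suc n) (True # s) = {}"
      using splitting[OF s(2)] by (simp add: splitting_def)
    then show False using mem eq n by (cases "\<alpha> n"; cases "\<beta> n") auto
  qed
  moreover have "(x, snd (p \<alpha>)) \<in> F" for \<alpha>
    using p(1)[of \<alpha>] x[of \<alpha>] by (metis prod.collapse)
  then have "range (\<lambda>\<alpha>. \<pi> (snd (p \<alpha>))) \<subseteq> \<pi> ` (F `` {x})"
    by blast
  then have "countable (range (\<lambda>\<alpha>. \<pi> (snd (p \<alpha>))))"
    using countable countable_subset by blast
  ultimately have "countable (UNIV :: (nat \<Rightarrow> bool) set)"
    using countable_image_inj_on by blast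
  then show False using uncountable_nat_bool by blast
qed

end

theorem countable_sections_cover:
  fixes M :: "'a::{complete_space, second_countable_topology} measure"
    and G :: "('a \<times> 'b::{complete_space, second_countable_topology}) set"
  assumes "finite_measure M" "sets M = sets borel" and G: "G \<in> sets borel"
    and countable: "\<And>x. countable (G `` {x})"
  shows "\<exists>f::nat \<Rightarrow> 'a \<Rightarrow> 'b. (\<forall>i. f i \<in> borel_measurable M) \<and>
    (AE x in M. \<forall>y. (x, y) \<in> G \<longrightarrow> (\<exists>i. y = f i x))"
proof -
  obtain F :: "(('a \<times> 'b) \<times> (nat \<Rightarrow> nat discrete)) set" where F: "closed F" "G = fst ` F"
    using borel_closed_projection[OF G] by (auto simp: closed_projection_def)
  \<comment> \<open>Regrouping \<open>((x, y), z)\<close> as \<open>(x, (y, z))\<close> makes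
    \<open>x\<close> the base point and \<open>fst\<close> the projection, so the projected fibres
    are the sections of \<open>G\<close>.\<close>
  define E where "E = (\<lambda>(x, y, z). ((x, y), z)) -` F"
  interpret fibre_cover M E fst
    using assms(1,2) by (intro fibre_cover.intro fibre_cover_axioms.intro) (auto intro: continuous_intros)
  have "closed E"
    unfolding E_def split_beta by (intro closed_vimage F continuous_intros)
  moreover have sect: "fst ` (E `` {x}) = G `` {x}" for x
    by (force simp: E_def F(2) Image_def image_iff)
  ultimately have "covered UNIV UNIV" using countable by (intro covered_UNIV) auto
  then obtain \<Phi> where \<Phi>: "countable \<Phi>" "\<Phi> \<subseteq> borel_measurable M"
    "AE x in M. \<forall>w. (x, w) \<in> E \<longrightarrow> (\<exists>f\<in>\<Phi>. fst w = f x)"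
    by (auto simp: covered_def)
  \<comment> \<open>The constant function only guards against an empty family, which has no
    enumeration.\<close>
  define f where "f = from_nat_into (insert (\<lambda>_. undefined) \<Phi>)"
  have f: "range f = insert (\<lambda>_. undefined) \<Phi>"
    unfolding f_def using \<Phi>(1) by (intro range_from_nat_into) auto
  then have "f i \<in> borel_measurable M" for i
    using \<Phi>(2) by (metis borel_measurable_const insertE rangeI subsetD)
  moreover have "AE x in M. \<forall>y. (x, y) \<in> G \<longrightarrow> (\<exists>i. y = f i x)"
    using \<Phi>(3)
  proof eventually_elim
    case (elim x)
    show ?case
    proof (intro allI impI)
      fix y assume "(x, y) \<in> G"
      then obtain z where "(x, y, z) \<in> E" by (force simp: E_def F(2))
      then obtain g where "g \<in> \<Phi>" "y = g x" using elim by force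
      then show "\<exists>i. y = f i x" using f by (metis insertI2 rangeE)
    qed
  qed
  ultimately show ?thesis by blast
qed

section \<open>Quasi-invariant measures\<close>

text \<open>The geometric distribution charges every index, so the mixture vanishes on a set exactly
  when each \<open>\<mu> i\<close> does.\<close>

lemma mixture_measure:
  fixes \<mu> :: "nat \<Rightarrow> 'a measure"
  assumes prob: "\<And>i. prob_space (\<mu> i)" and sets: "\<And>i. sets (\<mu> i) = sets S"
  shows "\<exists>N. prob_space N \<and> sets N = sets S \<and> null_sets N = (\<Inter>i. null_sets (\<mu> i))"
proof -
  let ?p = "measure_pmf (geometric_pmf (1/2))"
  define N where "N = ?p \<bind> \<mu>"
  have \<mu>: "\<mu> i \<in> space (subprob_algebra S)" for i
    using prob[of i] sets by (simp add: space_subprob_algebra prob_space_imp_subprob_space)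
  then have meas: "\<mu> \<in> measurable ?p (subprob_algebra S)"
    by (simp add: measurable_def)
  have "prob_space N"
    unfolding N_def using prob meas by (intro measure_pmf.prob_space_bind) auto
  moreover have sets_N: "sets N = sets S"
    unfolding N_def by (rule sets_bind[OF sets_kernel[OF meas]]) auto
  moreover have "emeasure N A = 0 \<longleftrightarrow> (\<forall>i. emeasure (\<mu> i) A = 0)" if "A \<in> sets S" for A
  proof -
    have "emeasure N A = (\<integral>\<^sup>+i. emeasure (\<mu> i) A \<partial>?p)"
      unfolding N_def by (rule emeasure_bind[OF _ meas that]) simp
    then show ?thesis
      by (simp add: nn_integral_0_iff_AE AE_measure_pmf_iff set_pmf_geometric)
  qed
  then have "null_sets N = (\<Inter>i. null_sets (\<mu> i))"
    using sets sets_N by (auto simp: null_sets_def)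
  ultimately show ?thesis by blast
qed

lemma quasi_invariant_step:
  fixes H :: "('a::{complete_space, second_countable_topology} \<times> 'a) set"
  assumes M: "prob_space M" "sets M = sets borel" and H: "H \<in> sets borel" "\<And>x. countable (H `` {x})"
  shows "\<exists>N. prob_space N \<and> sets N = sets borel \<and>
    (\<forall>Z\<in>null_sets N. \<exists>Y\<in>null_sets M. H\<inverse> `` Z \<subseteq> Y)"
proof -
  interpret M: prob_space M by fact
  obtain f where f: "\<And>i::nat. f i \<in> borel_measurable M"
    "AE x in M. \<forall>y. (x, y) \<in> H \<longrightarrow> (\<exists>i. y = f i x)"
    using countable_sections_cover[OF M.finite_measure_axioms M(2) H] by blast
  have "\<exists>N. prob_space N \<and> sets N = sets borel \<and> null_sets N = (\<Inter>i. null_sets (distr M borel (f i)))"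
    using f by (intro mixture_measure M.prob_space_distr) auto
  then obtain N where N: "prob_space N" "sets N = sets borel"
    "null_sets N = (\<Inter>i. null_sets (distr M borel (f i)))" by blast
  moreover have "\<exists>Y\<in>null_sets M. H\<inverse> `` Z \<subseteq> Y" if Z: "Z \<in> null_sets N" for Z
  proof -
    have "AE x in M. f i x \<notin> Z" for i
    proof (rule AE_I)
      have "Z \<in> null_sets (distr M borel (f i))" using Z N(3) by blast
      then show "emeasure M (f i -` Z \<inter> space M) = 0" "f i -` Z \<inter> space M \<in> sets M"
        using f(1)[of i] by (auto simp: null_sets_def emeasure_distr)
    qed auto
    then have "AE x in M. \<forall>i. f i x \<notin> Z" by (simp add: AE_all_countable)
    with f(2) have "AE x in M. \<not> (\<exists>y\<in>Z. (x, y) \<in> H)" by eventually_elim blast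
    then obtain Y where "Y \<in> null_sets M" "{x \<in> space M. \<not> \<not> (\<exists>y\<in>Z. (x, y) \<in> H)} \<subseteq> Y"
      by (auto elim!: AE_E simp: null_sets_def)
    then show ?thesis
      using sets_eq_imp_space_eq[OF M(2)] by (intro bexI[of _ Y]) auto
  qed
  ultimately show ?thesis by blast
qed

text \<open>In a chain starting with \<open>M\<close>, each measure controls neighbours with respect
  to its predecessor. A set null for the mixture is null for every \<open>\<mu> (Suc n)\<close>, so
  its neighbours are null for every \<open>\<mu> n\<close>: the shift of index is absorbed. Index 0
  is \<open>M\<close> itself, which gives the domination.\<close>

lemma quasi_invariant_measure:
  fixes H :: "('a::{complete_space, second_countable_topology} \<times> 'a) set"
  assumes M: "prob_space M" "sets M = sets borel" and H: "H \<in> sets borel" "\<And>x. countable (H `` {x})"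
  shows "\<exists>N. prob_space N \<and> sets N = sets borel \<and> null_sets N \<subseteq> null_sets M \<and>
    (\<forall>Z\<in>null_sets N. \<exists>Y\<in>null_sets N. H\<inverse> `` Z \<subseteq> Y)"
proof -
  let ?P = "\<lambda>M::'a measure. prob_space M \<and> sets M = sets borel"
  let ?Q = "\<lambda>(M::'a measure) N. \<forall>Z\<in>null_sets N. \<exists>Y\<in>null_sets M. H\<inverse> `` Z \<subseteq> Y"
  have "\<exists>\<mu>. \<forall>n::nat. (?P (\<mu> n) \<and> (n = 0 \<longrightarrow> \<mu> n = M)) \<and> ?Q (\<mu> n) (\<mu> (Suc n))"
    by (rule dependent_nat_choice) (use M quasi_invariant_step[OF _ _ H] in auto)
  then obtain \<mu> where \<mu>: "\<And>n. prob_space (\<mu> n)" "\<And>n. sets (\<mu> n) = sets borel" "\<mu> 0 = M"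
    "\<And>n. ?Q (\<mu> n) (\<mu> (Suc n))" by blast
  obtain N where N: "prob_space N" "sets N = sets borel" "null_sets N = (\<Inter>i. null_sets (\<mu> i))"
    using mixture_measure[of \<mu> borel] \<mu>(1,2) by blast
  moreover have "null_sets N \<subseteq> null_sets M" using N(3) \<mu>(3) by blast
  moreover have "\<exists>Y\<in>null_sets N. H\<inverse> `` Z \<subseteq> Y" if "Z \<in> null_sets N" for Z
  proof -
    have "\<forall>n. \<exists>Y. Y \<in> null_sets (\<mu> n) \<and> H\<inverse> `` Z \<subseteq> Y"
      using \<mu>(4) that N(3) by blast
    from choice[OF this] obtain Y where Y: "\<And>n. Y n \<in> null_sets (\<mu> n)" "\<And>n. H\<inverse> `` Z \<subseteq> Y n" by blast
    have sets_Y: "Y n \<in> sets borel" for n using Y(1)[of n] \<mu>(2) by (auto simp: null_sets_def)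
    \<comment> \<open>Each \<open>Y n\<close> is known to be null for one measure only; the
      intersection is null for all of them.\<close>
    have "(\<Inter>n. Y n) \<in> null_sets (\<mu> i)" for i
      by (rule null_sets_subset[OF Y(1)]) (use sets_Y \<mu>(2) in auto)
    then show ?thesis using Y(2) N(3) by (intro bexI[of _ "\<Inter>n. Y n"]) auto
  qed
  ultimately show ?thesis by blast
qed

text \<open>Countably many rounds of adding neighbours, each paid for with a null superset, give a
  null set closed under passing to neighbours; symmetry turns this into invariance.\<close>

lemma invariant_null_hull:
  assumes H: "sym H" and null: "\<And>Z. Z \<in> null_sets N \<Longrightarrow> \<exists>Y\<in>null_sets N. H\<inverse> `` Z \<subseteq> Y"
    and Z: "Z \<in> null_sets N"
  shows "\<exists>Y\<in>null_sets N. Z \<subseteq> Y \<and> (\<forall>(x, y)\<in>H. x \<in> Y \<longleftrightarrow> y \<in> Y)"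
proof -
  have "\<exists>Y. \<forall>n::nat. (Y n \<in> null_sets N \<and> (n = 0 \<longrightarrow> Y n = Z)) \<and> H\<inverse> `` Y n \<subseteq> Y (Suc n)"
    by (rule dependent_nat_choice) (use Z null in auto)
  then obtain Y where Y: "\<And>n. Y n \<in> null_sets N" "Y 0 = Z" "\<And>n. H\<inverse> `` Y n \<subseteq> Y (Suc n)" by blast
  have inv: "x \<in> (\<Union>n. Y n)" if "(x, y) \<in> H" "y \<in> (\<Union>n. Y n)" for x y
    using that Y(3) by blast
  show ?thesis
  proof (intro bexI conjI)
    show "(\<Union>n. Y n) \<in> null_sets N" using Y(1) by blast
    show "Z \<subseteq> (\<Union>n. Y n)" using Y(2) by blast
    show "\<forall>(x, y)\<in>H. x \<in> (\<Union>n. Y n) \<longleftrightarrow> y \<in> (\<Union>n. Y n)" using inv symD[OF H] by blast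
  qed
qed

section \<open>Random hitting sets\<close>

text \<open>Independence in counting form: divided by \<open>q ^ card S\<close>, this is the
  probability that a uniformly random colouring avoids colour 0 on \<open>T\<close>. Averages over
  the finite set of colourings stand in for a probability space of them.\<close>

lemma card_PiE_nonzero:
  fixes S :: "'a set"
  assumes "finite S" "T \<subseteq> S" "0 < q"
  shows "real (card {\<phi> \<in> S \<rightarrow>\<^sub>E {..<q}. \<forall>a\<in>T. \<phi> a \<noteq> (0::nat)}) = real q ^ card S * (1 - 1 / q) ^ card T"
proof -
  have "{\<phi> \<in> S \<rightarrow>\<^sub>E {..<q}. \<forall>a\<in>T. \<phi> a \<noteq> 0} = (\<Pi>\<^sub>E a\<in>S. if a \<in> T then {1..<q} else {..<q})"
  proof (rule set_eqI)
    fix \<phi> :: "'a \<Rightarrow> nat"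
    have "(\<forall>a\<in>S. \<phi> a < q) \<and> (\<forall>a\<in>T. \<phi> a \<noteq> 0) \<longleftrightarrow>
        (\<forall>a\<in>S. \<phi> a \<in> (if a \<in> T then {1..<q} else {..<q}))"
      using assms(2) by (auto simp: Suc_le_eq subset_iff)
    then show "\<phi> \<in> {\<phi> \<in> S \<rightarrow>\<^sub>E {..<q}. \<forall>a\<in>T. \<phi> a \<noteq> 0} \<longleftrightarrow>
        \<phi> \<in> (\<Pi>\<^sub>E a\<in>S. if a \<in> T then {1..<q} else {..<q})"
      unfolding PiE_iff mem_Collect_eq lessThan_iff by blast
  qed
  also have "card \<dots> = (\<Prod>a\<in>S. if a \<in> T then q - 1 else q)"
    using assms(1) by (auto simp: card_PiE intro!: prod.cong)
  also have "\<dots> = (q - 1) ^ card T * q ^ card (S - T)"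
    using assms(1,2) by (simp add: prod.If_cases Int_absorb1 Diff_eq)
  finally have "real (card {\<phi> \<in> S \<rightarrow>\<^sub>E {..<q}. \<forall>a\<in>T. \<phi> a \<noteq> 0}) = (real q - 1) ^ card T * q ^ card (S - T)"
    using assms(3) by (simp add: of_nat_diff)
  also have "(real q - 1) ^ card T = q ^ card T * (1 - 1 / q) ^ card T"
    using assms(3) by (simp add: power_mult_distrib[symmetric] right_diff_distrib)
  also have "card S = card T + card (S - T)"
    using assms(1,2) by (metis card_Diff_subset card_mono finite_subset le_add_diff_inverse)
  ultimately show ?thesis by (simp add: power_add)
qed

lemma card_PiE_zero:
  assumes "finite S" "a \<in> S" "0 < q"
  shows "real (card {\<phi> \<in> S \<rightarrow>\<^sub>E {..<q}. \<phi> a = (0::nat)}) = real q ^ card S * (1 / q)"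
proof -
  have fin: "finite (S \<rightarrow>\<^sub>E {..<q})" using assms(1) by (intro finite_PiE) auto
  have "card {\<phi> \<in> S \<rightarrow>\<^sub>E {..<q}. \<phi> a = 0} + card {\<phi> \<in> S \<rightarrow>\<^sub>E {..<q}. \<forall>b\<in>{a}. \<phi> b \<noteq> 0} =
      card ({\<phi> \<in> S \<rightarrow>\<^sub>E {..<q}. \<phi> a = 0} \<union> {\<phi> \<in> S \<rightarrow>\<^sub>E {..<q}. \<forall>b\<in>{a}. \<phi> b \<noteq> 0})"
    by (intro card_Un_disjoint[symmetric]) (auto intro: rev_finite_subset[OF fin])
  also have "{\<phi> \<in> S \<rightarrow>\<^sub>E {..<q}. \<phi> a = 0} \<union> {\<phi> \<in> S \<rightarrow>\<^sub>E {..<q}. \<forall>b\<in>{a}. \<phi> b \<noteq> 0} = S \<rightarrow>\<^sub>E {..<q}"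
    by auto
  also have "card \<dots> = q ^ card S" using assms(1) by (simp add: card_PiE)
  finally have "real (card {\<phi> \<in> S \<rightarrow>\<^sub>E {..<q}. \<phi> a = 0}) +
      real (card {\<phi> \<in> S \<rightarrow>\<^sub>E {..<q}. \<forall>b\<in>{a}. \<phi> b \<noteq> 0}) = real q ^ card S"
    unfolding of_nat_add[symmetric] of_nat_power[symmetric] by (rule arg_cong)
  then show ?thesis
    using card_PiE_nonzero[of S "{a}" q] assms by (simp add: right_diff_distrib)
qed

text \<open>Exchange of sum and integral. It carries counts of colourings that are bad at a single
  point over to the average measure of the bad sets.\<close>

lemma (in finite_measure) sum_measure_le_multiplicity:
  assumes "finite I" and [measurable]: "\<And>i. i \<in> I \<Longrightarrow> S i \<in> sets M"
    and "\<And>x. x \<in> space M \<Longrightarrow> real (card {i \<in> I. x \<in> S i}) \<le> c"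
  shows "(\<Sum>i\<in>I. measure M (S i)) \<le> c * measure M (space M)"
proof -
  have "(\<Sum>i\<in>I. measure M (S i)) = (\<Sum>i\<in>I. \<integral>x. indicator (S i) x \<partial>M)"
    using assms(2) sets.sets_into_space by (intro sum.cong) (auto simp: Int_absorb2)
  also have "\<dots> = (\<integral>x. (\<Sum>i\<in>I. indicator (S i) x) \<partial>M)"
    using assms(2) by (intro Bochner_Integration.integral_sum[symmetric])
      (auto simp: emeasure_finite less_top[symmetric])
  also have "\<dots> \<le> (\<integral>x. c \<partial>M)"
  proof (rule integral_mono)
    show "(\<Sum>i\<in>I. indicator (S i) x) \<le> c" if "x \<in> space M" for x
    proof -
      have "(\<Sum>i\<in>I. indicator (S i) x) = (\<Sum>i\<in>{i \<in> I. x \<in> S i}. 1 :: real)"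
        using assms(1) by (intro sum.mono_neutral_cong_right) auto
      then show ?thesis using assms(3)[OF that] by simp
    qed
  qed (use assms(2) in \<open>auto simp: emeasure_finite less_top[symmetric]\<close>)
  finally show ?thesis by (simp add: mult.commute)
qed

text \<open>Colour the cells of a fine finite partition independently with \<open>q\<close> colours and let \<open>E\<close> be the
  union of the cells of colour 0: for large \<open>q\<close> a given point is unlikely to lie in \<open>E\<close>, but for
  much larger \<open>K\<close> it is unlikely that \<open>K\<close> points of distinct cells all avoid it.\<close>

lemma (in prob_space) random_hitting_set:
  fixes h :: "nat \<Rightarrow> 'a \<Rightarrow> 'b::{second_countable_topology, t2_space}"
  assumes h [measurable]: "\<And>n. h n \<in> borel_measurable M"
    and A [measurable]: "A \<in> sets M" and inj: "\<And>x. x \<in> A \<Longrightarrow> inj (\<lambda>n. h n x)"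
    and \<epsilon>: "0 < \<epsilon>"
  shows "\<exists>E K. E \<in> sets borel \<and>
    (\<Sum>n<\<kappa>. prob {x \<in> space M. h n x \<in> E}) + prob {x \<in> A. \<forall>n<K. h n x \<notin> E} < \<epsilon>"
proof -
  \<comment> \<open>The error is split in three: colour 0 on the first \<open>\<kappa>\<close>
    points \<open>h n x\<close> costs \<open>\<kappa> / q\<close>, avoidance of colour 0 by
    \<open>K\<close> distinct cells costs \<open>(1 - 1 / q) ^ K\<close>, and the last third is kept
    for points \<open>x\<close> whose first \<open>K\<close> values the finite partition does not
    yet separate.\<close>
  obtain q :: nat where q: "3 * \<kappa> / \<epsilon> < q" using reals_Archimedean2 by blast
  moreover have "0 \<le> 3 * \<kappa> / \<epsilon>" using \<epsilon> by simp
  ultimately have q_pos: "0 < q" by linarith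
  have q_\<epsilon>: "\<kappa> / q < \<epsilon> / 3" using q q_pos \<epsilon> by (simp add: field_simps)
  obtain K where K: "(1 - 1 / real q) ^ K < \<epsilon> / 3"
    using real_arch_pow_inv[of "\<epsilon> / 3" "1 - 1 / real q"] \<epsilon> q_pos by auto
  obtain \<B> :: "'b set set" where \<B>: "countable \<B>" "topological_basis \<B>"
    using ex_countable_basis by blast
  define B where "B = from_nat_into (insert UNIV \<B>)"
  have range_B: "range B = insert UNIV \<B>"
    unfolding B_def using \<B>(1) by (intro range_from_nat_into) auto
  have "open (B i)" for i
    using range_B topological_basis_open[OF \<B>(2)] rangeI[of B i] by auto
  then have [measurable]: "B i \<in> sets borel" for i by (rule borel_open)
  have sep: "\<exists>i. y \<in> B i \<and> z \<notin> B i" if "y \<noteq> z" for y z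
  proof -
    obtain U where U: "open U" "y \<in> U" "z \<notin> U" using t1_space[OF \<open>y \<noteq> z\<close>] by blast
    obtain C where C: "C \<in> \<B>" "y \<in> C" "C \<subseteq> U" using topological_basisE[OF \<B>(2) U(1,2)] by blast
    then have "C \<in> range B" using range_B by blast
    then show ?thesis using C U(3) by blast
  qed
  \<comment> \<open>The code of the cell of \<open>y\<close> in the partition generated by the first
    \<open>m\<close> sets \<open>B i\<close>; colourings act on such codes.\<close>
  define c where "c m y = {i. i < m \<and> y \<in> B i}" for m y
  have c_eq_iff: "c m y = c m z \<longleftrightarrow> (\<forall>i<m. y \<in> B i \<longleftrightarrow> z \<in> B i)" for m y z
    by (auto simp: c_def)
  have [measurable]: "{y. \<phi> (c m y) = (0::nat)} \<in> sets borel" for \<phi> m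
  proof -
    have "{y. \<phi> (c m y) = 0} = (\<Union>a\<in>{a \<in> Pow {..<m}. \<phi> a = 0}. {y. \<forall>i. i \<in> a \<longleftrightarrow> i < m \<and> y \<in> B i})"
    proof (intro set_eqI iffI)
      fix y assume "y \<in> {y. \<phi> (c m y) = 0}"
      then show "y \<in> (\<Union>a\<in>{a \<in> Pow {..<m}. \<phi> a = 0}. {y. \<forall>i. i \<in> a \<longleftrightarrow> i < m \<and> y \<in> B i})"
        by (intro UN_I[of "c m y"]) (auto simp: c_def)
    next
      fix y assume "y \<in> (\<Union>a\<in>{a \<in> Pow {..<m}. \<phi> a = 0}. {y. \<forall>i. i \<in> a \<longleftrightarrow> i < m \<and> y \<in> B i})"
      then obtain a where a: "\<phi> a = 0" "\<forall>i. i \<in> a \<longleftrightarrow> i < m \<and> y \<in> B i" by blast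
      then have "a = c m y" by (auto simp: c_def)
      then show "y \<in> {y. \<phi> (c m y) = 0}" using a(1) by simp
    qed
    also have "\<dots> \<in> sets borel"
      by (rule sets.finite_UN) (auto simp: Collect_all_eq intro!: pred_sets1)
    finally show ?thesis .
  qed
  \<comment> \<open>Here the first \<open>K\<close> points lie in pairwise distinct cells, so that
    their colours are independent.\<close>
  define W where "W m = {x \<in> A. \<forall>n<K. \<forall>k<K. n \<noteq> k \<longrightarrow> (\<exists>i<m. (h n x \<in> B i) \<noteq> (h k x \<in> B i))}" for m
  have A_space: "x \<in> space M" if "x \<in> A" for x using that sets.sets_into_space[OF A] by blast
  have W_eq: "W m = {x \<in> space M. x \<in> A \<and> (\<forall>n<K. \<forall>k<K. n \<noteq> k \<longrightarrow> (\<exists>i<m. (h n x \<in> B i) \<noteq> (h k x \<in> B i)))}" for m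
    using A_space by (auto simp: W_def)
  have [measurable]: "W m \<in> sets M" for m
    unfolding W_eq by measurable
  have "(\<lambda>m. prob (A - W m)) \<longlonglongrightarrow> prob (\<Inter>m. A - W m)"
  proof (rule finite_Lim_measure_decseq)
    show "decseq (\<lambda>m. A - W m)"
      by (intro decseq_SucI) (auto simp: W_def less_Suc_eq)
  qed auto
  \<comment> \<open>Any two of the \<open>K\<close> distinct points are separated by some
    \<open>B i\<close>, and finitely many indices serve all pairs, so every point of
    \<open>A\<close> enters some \<open>W m\<close>.\<close>
  moreover have "(\<Inter>m. A - W m) = {}"
  proof -
    have "\<exists>m. x \<in> W m" if x: "x \<in> A" for x
    proof -
      have "\<exists>i. n \<noteq> k \<longrightarrow> (h n x \<in> B i) \<noteq> (h k x \<in> B i)" for n k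
        using sep[of "h n x" "h k x"] inj[OF x] by (auto dest: injD)
      then obtain i where i: "\<And>n k. n \<noteq> k \<Longrightarrow> (h n x \<in> B (i n k)) \<noteq> (h k x \<in> B (i n k))" by metis
      have "finite ((\<lambda>(n, k). i n k) ` ({..<K} \<times> {..<K}))" by simp
      then obtain m where "\<forall>j\<in>(\<lambda>(n, k). i n k) ` ({..<K} \<times> {..<K}). j < m"
        using finite_nat_set_iff_bounded by blast
      then have "i n k < m" if "n < K" "k < K" for n k using that by blast
      then have "x \<in> W m" using x i unfolding W_def by blast
      then show ?thesis ..
    qed
    then show ?thesis by blast
  qed
  ultimately have "(\<lambda>m. prob (A - W m)) \<longlonglongrightarrow> 0" by (simp only: measure_empty)
  then have "\<forall>\<^sub>F m in sequentially. prob (A - W m) < \<epsilon> / 3"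
    by (rule order_tendstoD) (use \<epsilon> in simp)
  then obtain m where m: "prob (A - W m) < \<epsilon> / 3"
    by (auto simp: eventually_sequentially)
  define S where "S = Pow {..<m}"
  have S: "finite S" "c m y \<in> S" for y by (auto simp: S_def c_def)
  define \<Phi> where "\<Phi> = (S \<rightarrow>\<^sub>E {..<q})"
  have \<Phi>: "finite \<Phi>" "real (card \<Phi>) = real q ^ card S"
    using S(1) by (auto simp: \<Phi>_def card_PiE intro: finite_PiE)
  have [measurable]: "{x \<in> space M. \<phi> (c m (h n x)) = 0} \<in> sets M" for \<phi> :: "nat set \<Rightarrow> nat" and n
    using measurable_sets_Collect[OF h[of n], of "\<lambda>y. \<phi> (c m y) = 0"] by simp
  define Y where "Y \<phi> = {x \<in> space M. x \<in> W m \<and> (\<forall>n<K. \<phi> (c m (h n x)) \<noteq> 0)}" for \<phi> :: "nat set \<Rightarrow> nat"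
  have [measurable]: "Y \<phi> \<in> sets M" for \<phi>
    unfolding Y_def by measurable
  have hit: "(\<Sum>\<phi>\<in>\<Phi>. prob {x \<in> space M. \<phi> (c m (h n x)) = 0}) \<le> real (card \<Phi>) * (1 / q) * prob (space M)" for n
  proof (rule sum_measure_le_multiplicity[OF \<Phi>(1)])
    fix x
    have "{\<phi> \<in> \<Phi>. x \<in> {x \<in> space M. \<phi> (c m (h n x)) = 0}} \<subseteq> {\<phi> \<in> S \<rightarrow>\<^sub>E {..<q}. \<phi> (c m (h n x)) = 0}"
      by (auto simp: \<Phi>_def)
    then have "card {\<phi> \<in> \<Phi>. x \<in> {x \<in> space M. \<phi> (c m (h n x)) = 0}} \<le> card {\<phi> \<in> S \<rightarrow>\<^sub>E {..<q}. \<phi> (c m (h n x)) = 0}"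
      using \<Phi>(1) by (intro card_mono) (auto simp: \<Phi>_def)
    from of_nat_mono[where 'a=real, OF this]
    show "real (card {\<phi> \<in> \<Phi>. x \<in> {x \<in> space M. \<phi> (c m (h n x)) = 0}}) \<le> real (card \<Phi>) * (1 / q)"
      unfolding card_PiE_zero[OF S q_pos] \<Phi>(2) .
  qed auto
  have miss: "(\<Sum>\<phi>\<in>\<Phi>. prob (Y \<phi>)) \<le> real (card \<Phi>) * (1 - 1 / q) ^ K * prob (space M)"
  proof (rule sum_measure_le_multiplicity[OF \<Phi>(1)])
    fix x
    show "real (card {\<phi> \<in> \<Phi>. x \<in> Y \<phi>}) \<le> real (card \<Phi>) * (1 - 1 / q) ^ K"
    proof (cases "x \<in> W m")
      case False
      then show ?thesis using q_pos by (simp add: Y_def)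
    next
      case True
      let ?T = "(\<lambda>n. c m (h n x)) ` {..<K}"
      have "inj_on (\<lambda>n. c m (h n x)) {..<K}"
        using True by (auto simp: W_def inj_on_def c_eq_iff)
      then have T: "card ?T = K" "?T \<subseteq> S" using S(2) by (auto simp: card_image)
      have "{\<phi> \<in> \<Phi>. x \<in> Y \<phi>} \<subseteq> {\<phi> \<in> S \<rightarrow>\<^sub>E {..<q}. \<forall>a\<in>?T. \<phi> a \<noteq> 0}"
        by (auto simp: \<Phi>_def Y_def)
      then have "card {\<phi> \<in> \<Phi>. x \<in> Y \<phi>} \<le> card {\<phi> \<in> S \<rightarrow>\<^sub>E {..<q}. \<forall>a\<in>?T. \<phi> a \<noteq> 0}"
        using \<Phi>(1) by (intro card_mono) (auto simp: \<Phi>_def)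
      from of_nat_mono[where 'a=real, OF this] show ?thesis
        unfolding card_PiE_nonzero[OF S(1) T(2) q_pos] \<Phi>(2) T(1) .
    qed
  qed auto
  \<comment> \<open>The average over all colourings is below the bound, so some colouring
    is.\<close>
  have "\<exists>\<phi>\<in>\<Phi>. (\<Sum>n<\<kappa>. prob {x \<in> space M. \<phi> (c m (h n x)) = 0}) + prob (Y \<phi>) < 2 * \<epsilon> / 3"
  proof (rule ccontr)
    assume "\<not> ?thesis"
    then have "real (card \<Phi>) * (2 * \<epsilon> / 3) \<le>
        (\<Sum>\<phi>\<in>\<Phi>. (\<Sum>n<\<kappa>. prob {x \<in> space M. \<phi> (c m (h n x)) = 0}) + prob (Y \<phi>))"
      by (intro sum_bounded_below) (auto simp: not_less)
    also have "\<dots> = (\<Sum>n<\<kappa>. \<Sum>\<phi>\<in>\<Phi>. prob {x \<in> space M. \<phi> (c m (h n x)) = 0}) + (\<Sum>\<phi>\<in>\<Phi>. prob (Y \<phi>))"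
      by (simp add: sum.distrib sum.swap[of _ "{..<\<kappa>}"])
    also have "\<dots> \<le> \<kappa> * (real (card \<Phi>) * (1 / q)) + real (card \<Phi>) * (1 - 1 / q) ^ K"
    proof (rule add_mono)
      show "(\<Sum>n<\<kappa>. \<Sum>\<phi>\<in>\<Phi>. prob {x \<in> space M. \<phi> (c m (h n x)) = 0}) \<le> \<kappa> * (real (card \<Phi>) * (1 / q))"
        using sum_bounded_above[of "{..<\<kappa>}" "\<lambda>n. \<Sum>\<phi>\<in>\<Phi>. prob {x \<in> space M. \<phi> (c m (h n x)) = 0}", OF hit]
        by (simp add: prob_space)
      show "(\<Sum>\<phi>\<in>\<Phi>. prob (Y \<phi>)) \<le> real (card \<Phi>) * (1 - 1 / q) ^ K"
        using miss by (simp add: prob_space)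
    qed
    also have "\<dots> = real (card \<Phi>) * (\<kappa> / q + (1 - 1 / q) ^ K)"
      by (simp add: algebra_simps)
    also have "\<dots> < real (card \<Phi>) * (2 * \<epsilon> / 3)"
      using q_\<epsilon> K q_pos \<Phi>(2) by (intro mult_strict_left_mono) auto
    finally show False by simp
  qed
  then obtain \<phi> where \<phi>: "(\<Sum>n<\<kappa>. prob {x \<in> space M. \<phi> (c m (h n x)) = 0}) + prob (Y \<phi>) < 2 * \<epsilon> / 3"
    by blast
  define E where "E = {y. \<phi> (c m y) = 0}"
  have [measurable]: "E \<in> sets borel" by (simp add: E_def)
  have "{x \<in> A. \<forall>n<K. h n x \<notin> E} \<subseteq> Y \<phi> \<union> (A - W m)"
    using A_space by (auto simp: Y_def E_def)
  then have "prob {x \<in> A. \<forall>n<K. h n x \<notin> E} \<le> prob (Y \<phi> \<union> (A - W m))"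
    by (intro finite_measure_mono) auto
  also have "\<dots> \<le> prob (Y \<phi>) + prob (A - W m)"
    by (intro measure_Un_le) auto
  finally have "(\<Sum>n<\<kappa>. prob {x \<in> space M. h n x \<in> E}) + prob {x \<in> A. \<forall>n<K. h n x \<notin> E} < \<epsilon>"
    using \<phi> m by (simp add: E_def)
  then show ?thesis by (intro exI[of _ E] exI[of _ K]) simp
qed

text \<open>The sets \<open>E k\<close> are found in turn: each is hit within \<open>K k\<close>
  points up to error \<open>(1/2) ^ k\<close>, and each is rarely met by the points that its
  predecessors rely on. A class is the union of an infinite column of the trimmed sets; its failure
  is bounded by arbitrarily late errors, hence null.\<close>

lemma (in prob_space) disjoint_hitting_sets:
  fixes h :: "nat \<Rightarrow> 'a \<Rightarrow> 'b::{second_countable_topology, t2_space}"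
  assumes h [measurable]: "\<And>n. h n \<in> borel_measurable M"
    and A [measurable]: "A \<in> sets M" and inj: "\<And>x. x \<in> A \<Longrightarrow> inj (\<lambda>n. h n x)"
  shows "\<exists>D::nat \<Rightarrow> 'b set. (\<forall>j. D j \<in> sets borel) \<and> disjoint_family D \<and>
    (AE x in M. x \<in> A \<longrightarrow> (\<forall>j. \<exists>n. h n x \<in> D j))"
proof -
  have A_space: "x \<in> space M" if "x \<in> A" for x using that sets.sets_into_space[OF A] by blast
  define P :: "nat \<Rightarrow> 'b set \<times> nat \<Rightarrow> bool" where
    "P k = (\<lambda>(E, K). E \<in> sets borel \<and> prob {x \<in> A. \<forall>n<K. h n x \<notin> E} \<le> (1/2) ^ k)" for k
  define Q :: "nat \<Rightarrow> 'b set \<times> nat \<Rightarrow> 'b set \<times> nat \<Rightarrow> bool" where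
    "Q k = (\<lambda>(E, K) (E', K'). K \<le> K' \<and> (\<Sum>n<K. prob {x \<in> space M. h n x \<in> E'}) \<le> (1/2) ^ Suc k)" for k
  have step: "\<exists>q. P k q \<and> snd p \<le> snd q \<and> (\<Sum>n<snd p. prob {x \<in> space M. h n x \<in> fst q}) \<le> (1/2) ^ k"
    for k and p :: "'b set \<times> nat"
  proof -
    obtain E K where E [measurable]: "E \<in> sets borel"
      and less: "(\<Sum>n<snd p. prob {x \<in> space M. h n x \<in> E}) + prob {x \<in> A. \<forall>n<K. h n x \<notin> E} < (1/2) ^ k"
      using random_hitting_set[OF h A inj, of "(1/2) ^ k" "snd p"] by auto
    have eq: "{x \<in> A. \<forall>n<L. h n x \<notin> E} = {x \<in> space M. x \<in> A \<and> (\<forall>n<L. h n x \<notin> E)}" for L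
      using A_space by auto
    \<comment> \<open>The maximum keeps \<open>K\<close> nondecreasing, so that an estimate for the
      first \<open>K (k + i)\<close> points also serves the first \<open>K k\<close>.\<close>
    have "prob {x \<in> A. \<forall>n<max K (snd p). h n x \<notin> E} \<le> prob {x \<in> A. \<forall>n<K. h n x \<notin> E}"
      unfolding eq by (intro finite_measure_mono) auto
    moreover have "0 \<le> prob {x \<in> A. \<forall>n<K. h n x \<notin> E}"
      "0 \<le> (\<Sum>n<snd p. prob {x \<in> space M. h n x \<in> E})"
      by (auto intro: sum_nonneg)
    ultimately have "prob {x \<in> A. \<forall>n<max K (snd p). h n x \<notin> E} \<le> (1/2) ^ k"
      "(\<Sum>n<snd p. prob {x \<in> space M. h n x \<in> E}) \<le> (1/2) ^ k"
      using less by linarith+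
    then show ?thesis
      using E by (intro exI[of _ "(E, max K (snd p))"]) (simp add: P_def)
  qed
  have "\<exists>f. \<forall>k. P k (f k) \<and> Q k (f k) (f (Suc k))"
  proof (rule dependent_nat_choice)
    show "\<exists>p. P 0 p" using step[of 0] by blast
    show "\<exists>q. P (Suc k) q \<and> Q k p q" for p k
      using step[of "Suc k" p] by (auto simp: Q_def split_beta)
  qed
  then obtain f where f: "\<And>k. P k (f k) \<and> Q k (f k) (f (Suc k))" by blast
  define E K where "E k = fst (f k)" and "K k = snd (f k)" for k
  have E [measurable]: "E k \<in> sets borel"
    and miss: "prob {x \<in> A. \<forall>n<K k. h n x \<notin> E k} \<le> (1/2) ^ k"
    and K_Suc: "K k \<le> K (Suc k)"
    and hit: "(\<Sum>n<K k. prob {x \<in> space M. h n x \<in> E (Suc k)}) \<le> (1/2) ^ Suc k" for k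
    using f[of k] by (auto simp: P_def Q_def E_def K_def split_beta)
  have K_mono: "K k \<le> K l" if "k \<le> l" for k l
    using lift_Suc_mono_le[of K k l] K_Suc that by blast
  define T where "T k = (\<Union>i. E (Suc k + i))" for k
  have [measurable]: "T k \<in> sets borel" for k
    unfolding T_def by measurable
  \<comment> \<open>Later sets take precedence. They are so sparse that they rarely contain the first \<open>K k\<close>
    neighbours, where \<open>E k\<close> is already met.\<close>
  define E' where "E' k = E k - T k" for k
  have [measurable]: "E' k \<in> sets borel" for k
    unfolding E'_def by measurable
  have disj: "E' k \<inter> E' l = {}" if "k < l" for k l
  proof -
    obtain i where "l = Suc k + i" using less_imp_Suc_add[OF \<open>k < l\<close>] by auto
    then show ?thesis by (auto simp: E'_def T_def)
  qed
  have late: "prob {x \<in> space M. \<exists>n<K k. h n x \<in> T k} \<le> (1/2) ^ k" for k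
  proof -
    let ?S = "\<lambda>i. {x \<in> space M. \<exists>n<K k. h n x \<in> E (Suc k + i)}"
    have S: "prob (?S i) \<le> (1/2) ^ Suc (k + i)" for i
    proof -
      have "?S i = (\<Union>n<K k. {x \<in> space M. h n x \<in> E (Suc k + i)})" by auto
      then have "prob (?S i) \<le> (\<Sum>n<K k. prob {x \<in> space M. h n x \<in> E (Suc k + i)})"
        by (simp only:, intro finite_measure_subadditive_finite) auto
      also have "\<dots> \<le> (\<Sum>n<K (k + i). prob {x \<in> space M. h n x \<in> E (Suc k + i)})"
        using K_mono[of k "k + i"] by (intro sum_mono2) auto
      also have "\<dots> \<le> (1/2) ^ Suc (k + i)" using hit[of "k + i"] by simp
      finally show ?thesis .
    qed
    have geo: "(\<lambda>i. (1/2::real) ^ Suc (k + i)) sums (1/2) ^ k"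
    proof -
      have "(\<lambda>i. (1/2) ^ Suc k * (1/2::real) ^ i) sums ((1/2) ^ Suc k * (1 / (1 - 1/2)))"
        by (intro sums_mult geometric_sums) auto
      then show ?thesis by (simp add: power_add mult.assoc)
    qed
    have summable: "summable (\<lambda>i. prob (?S i))"
      using S by (intro summable_comparison_test[OF _ sums_summable[OF geo]]) auto
    have "{x \<in> space M. \<exists>n<K k. h n x \<in> T k} = (\<Union>i. ?S i)" by (auto simp: T_def)
    then have "prob {x \<in> space M. \<exists>n<K k. h n x \<in> T k} \<le> (\<Sum>i. prob (?S i))"
      using summable by (simp only:, intro finite_measure_subadditive_countably) auto
    also have "\<dots> \<le> (\<Sum>i. (1/2) ^ Suc (k + i))"
      using S summable sums_summable[OF geo] by (intro suminf_le)
    also have "\<dots> = (1/2) ^ k" using geo by (rule sums_unique[symmetric])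
    finally show ?thesis .
  qed
  define D where "D j = (\<Union>i. E' (prod_encode (j, i)))" for j
  have [measurable]: "D j \<in> sets borel" for j
    unfolding D_def by measurable
  have "disjoint_family D"
  proof (unfold disjoint_family_on_def, intro ballI impI)
    fix j j' :: nat assume "j \<noteq> j'"
    then have "prod_encode (j, i) \<noteq> prod_encode (j', i')" for i i'
      using inj_eq[OF inj_prod_encode] by blast
    then have "E' (prod_encode (j, i)) \<inter> E' (prod_encode (j', i')) = {}" for i i'
      using disj by (metis Int_commute linorder_neqE_nat)
    then show "D j \<inter> D j' = {}" unfolding D_def by blast
  qed
  moreover have "AE x in M. x \<in> A \<longrightarrow> (\<exists>n. h n x \<in> D j)" for j
  proof -
    let ?N = "{x \<in> space M. x \<in> A \<and> (\<forall>n. h n x \<notin> D j)}"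
    have "prob ?N \<le> 2 * (1/2) ^ i" for i
    proof -
      define k where "k = prod_encode (j, i)"
      \<comment> \<open>The pairing dominates its second argument, so the index \<open>k\<close>
        tends to infinity along column \<open>j\<close>.\<close>
      have "i \<le> k" unfolding k_def by (rule le_prod_encode_2)
      let ?X = "{x \<in> space M. x \<in> A \<and> (\<forall>n<K k. h n x \<notin> E k)}"
      let ?Y = "{x \<in> space M. \<exists>n<K k. h n x \<in> T k}"
      \<comment> \<open>A point that misses \<open>D j\<close> misses \<open>E' k\<close>, so any of
        its first \<open>K k\<close> neighbours in \<open>E k\<close> must lie in the removed part
        \<open>T k\<close>.\<close>
      have "?N \<subseteq> ?X \<union> ?Y"
        unfolding D_def E'_def k_def by blast
      then have "prob ?N \<le> prob (?X \<union> ?Y)" by (intro finite_measure_mono) auto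
      also have "\<dots> \<le> prob ?X + prob ?Y" by (intro measure_Un_le) auto
      also have "?X = {x \<in> A. \<forall>n<K k. h n x \<notin> E k}" using A_space by auto
      also have "prob {x \<in> A. \<forall>n<K k. h n x \<notin> E k} + prob ?Y \<le> (1/2) ^ k + (1/2) ^ k"
        using miss late by (intro add_mono)
      also have "\<dots> \<le> 2 * (1/2) ^ i"
        using power_decreasing[OF \<open>i \<le> k\<close>, of "1/2 :: real"] by simp
      finally show ?thesis .
    qed
    moreover have "(\<lambda>i. 2 * (1/2::real) ^ i) \<longlonglongrightarrow> 2 * 0"
      by (intro tendsto_intros) auto
    ultimately have "prob ?N \<le> 0"
      by (intro LIMSEQ_le_const[of "\<lambda>i. 2 * (1/2::real) ^ i"]) auto
    then have "emeasure M ?N = 0"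
      by (simp add: emeasure_eq_measure measure_le_0_iff)
    then show ?thesis by (intro AE_I[of _ _ ?N]) auto
  qed
  then have "AE x in M. \<forall>j. x \<in> A \<longrightarrow> (\<exists>n. h n x \<in> D j)" unfolding AE_all_countable by blast
  then have "AE x in M. x \<in> A \<longrightarrow> (\<forall>j. \<exists>n. h n x \<in> D j)" by eventually_elim blast
  ultimately show ?thesis by (intro exI[of _ D]) auto
qed

section \<open>Measurable enumeration of distinct neighbours\<close>

primrec nth_index :: "(nat \<Rightarrow> bool) \<Rightarrow> nat \<Rightarrow> nat" where
  "nth_index P 0 = (LEAST i. P i)"
| "nth_index P (Suc n) = (LEAST i. P i \<and> nth_index P n < i)"

lemma nth_index:
  assumes "infinite {i. P i}"
  shows "P (nth_index P n)" "nth_index P n < nth_index P (Suc n)"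
proof -
  have ex: "\<exists>i. P i \<and> m < i" for m
    using assms by (auto simp: infinite_nat_iff_unbounded)
  show "P (nth_index P n)"
    using LeastI_ex[OF ex] LeastI_ex[of P] ex by (cases n) auto
  show "nth_index P n < nth_index P (Suc n)"
    using LeastI_ex[OF ex] by simp
qed

text \<open>Each index is the least one satisfying a condition that depends measurably on
  \<open>x\<close> and on the previous, countably valued index; so measurability passes along the
  recursion.\<close>

lemma measurable_nth_index [measurable]:
  assumes [measurable]: "\<And>i. Measurable.pred M (\<lambda>x. P x i)"
  shows "(\<lambda>x. nth_index (P x) n) \<in> M \<rightarrow>\<^sub>M count_space UNIV"
proof (induction n)
  case (Suc n)
  note [measurable] = Suc
  show ?case by simp
qed simp

lemma (in prob_space) measurable_domatic_ae:
  fixes f :: "nat \<Rightarrow> 'a \<Rightarrow> 'b::{second_countable_topology, t2_space}"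
  assumes f [measurable]: "\<And>i. f i \<in> borel_measurable M"
    and G [measurable]: "\<And>i. {x \<in> space M. (x, f i x) \<in> G} \<in> sets M"
    and cover: "AE x in M. \<forall>y. (x, y) \<in> G \<longrightarrow> (\<exists>i. y = f i x)"
  shows "\<exists>D::nat \<Rightarrow> 'b set. (\<forall>j. D j \<in> sets borel) \<and> disjoint_family D \<and>
    (AE x in M. infinite (G `` {x}) \<longrightarrow> (\<forall>j. D j \<inter> G `` {x} \<noteq> {}))"
proof -
  \<comment> \<open>Only the first index of a value counts, and only if the value is a neighbour:
    the functions merely cover the sections and may repeat values or leave \<open>G\<close>.\<close>
  define P where "P x i \<longleftrightarrow> (x, f i x) \<in> G \<and> (\<forall>j<i. f j x \<noteq> f i x)" for x i
  have P_D: "(x, f i x) \<in> G" "\<And>j. j < i \<Longrightarrow> f j x \<noteq> f i x" if "P x i" for x i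
    using that by (auto simp: P_def)
  have [measurable]: "Measurable.pred M (\<lambda>x. (x, f i x) \<in> G)" for i using G[of i] by (simp add: pred_def)
  have [measurable]: "Measurable.pred M (\<lambda>x. P x i)" for i
    unfolding P_def by measurable
  define h where "h n x = f (nth_index (P x) n) x" for n x
  have h: "h n \<in> borel_measurable M" for n
    unfolding h_def by (rule measurable_compose_countable) auto
  define A where "A = {x \<in> space M. \<forall>m. \<exists>i. m < i \<and> P x i}"
  have A: "A \<in> sets M" unfolding A_def by measurable
  have P: "infinite {i. P x i}" if "x \<in> A" for x
    using that by (auto simp: A_def infinite_nat_iff_unbounded)
  have inj: "inj (\<lambda>n. h n x)" if "x \<in> A" for x
  proof -
    have "h m x \<noteq> h n x" if "m < n" for m n
    proof -
      have "nth_index (P x) m < nth_index (P x) n"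
        using nth_index(2)[OF P[OF \<open>x \<in> A\<close>]] \<open>m < n\<close> by (rule lift_Suc_mono_less)
      then show ?thesis unfolding h_def by (rule P_D(2)[OF nth_index(1)[OF P[OF \<open>x \<in> A\<close>]]])
    qed
    then show ?thesis by (auto intro!: injI) (metis linorder_neqE_nat)
  qed
  obtain D :: "nat \<Rightarrow> 'b set" where D: "\<forall>j. D j \<in> sets borel" "disjoint_family D"
    "AE x in M. x \<in> A \<longrightarrow> (\<forall>j. \<exists>n. h n x \<in> D j)"
    using disjoint_hitting_sets[OF h A inj] by blast
  have "AE x in M. infinite (G `` {x}) \<longrightarrow> (\<forall>j. D j \<inter> G `` {x} \<noteq> {})"
    using D(3) cover AE_space
  proof eventually_elim
    case (elim x)
    show ?case
    proof (intro impI allI)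
      fix j assume inf: "infinite (G `` {x})"
      have "G `` {x} \<subseteq> (\<lambda>i. f i x) ` {i. P x i}"
      proof
        fix y assume y: "y \<in> G `` {x}"
        define i where "i = (LEAST i. y = f i x)"
        have i: "y = f i x" unfolding i_def by (rule LeastI_ex) (use y elim(2) in auto)
        have "f k x \<noteq> f i x" if "k < i" for k
          using not_less_Least[of k "\<lambda>i. y = f i x"] that i unfolding i_def by metis
        then have "P x i" using y i by (auto simp: P_def)
        then show "y \<in> (\<lambda>i. f i x) ` {i. P x i}" using i by blast
      qed
      then have "infinite {i. P x i}" using inf finite_surj by blast
      then have "x \<in> A" using elim(3) by (auto simp: A_def infinite_nat_iff_unbounded)
      then obtain n where "h n x \<in> D j" using elim(1) by blast
      moreover have "(x, h n x) \<in> G"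
        unfolding h_def by (rule P_D(1)[OF nth_index(1)[OF P[OF \<open>x \<in> A\<close>]]])
      ultimately show "D j \<inter> G `` {x} \<noteq> {}" by blast
    qed
  qed
  then show ?thesis using D(1,2) by blast
qed

section \<open>Countable components\<close>

text \<open>Stage \<open>k\<close> decodes to a pair: a new point is taken from the set named by the
  first component, which is possible since finitely many points were used before, and given to the
  class named by the second. So every set serves every class.\<close>

lemma disjoint_transversals:
  fixes S :: "nat \<Rightarrow> 'a set"
  assumes "\<And>n. infinite (S n)"
  shows "\<exists>C::nat \<Rightarrow> 'a set. disjoint_family C \<and> (\<forall>n j. C j \<inter> S n \<noteq> {})"
proof -
  have "\<exists>y. \<forall>k::nat. y k \<in> S (fst (prod_decode k)) \<and> y k \<notin> y ` {..<k}"
  proof (rule dependent_wellorder_choice)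
    fix f :: "nat \<Rightarrow> 'a" and k :: nat
    have "infinite (S (fst (prod_decode k)) - f ` {..<k})" using assms by simp
    then show "\<exists>r. r \<in> S (fst (prod_decode k)) \<and> r \<notin> f ` {..<k}"
      by (metis DiffE finite.emptyI ex_in_conv)
  next
    fix r :: 'a and f g :: "nat \<Rightarrow> 'a" and k :: nat
    assume "\<And>l. l < k \<Longrightarrow> f l = g l"
    then have "f ` {..<k} = g ` {..<k}" by (intro image_cong) auto
    then show "(r \<in> S (fst (prod_decode k)) \<and> r \<notin> f ` {..<k}) \<longleftrightarrow>
        (r \<in> S (fst (prod_decode k)) \<and> r \<notin> g ` {..<k})" by simp
  qed
  then obtain y where y: "\<And>k. y k \<in> S (fst (prod_decode k))" "\<And>k. y k \<notin> y ` {..<k}" by blast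
  have inj: "y k \<noteq> y l" if "k \<noteq> l" for k l
    using that y(2)[of k] y(2)[of l] by (metis imageI lessThan_iff linorder_neqE_nat)
  define C where "C j = (\<lambda>i. y (prod_encode (i, j))) ` UNIV" for j
  have "disjoint_family C"
    unfolding disjoint_family_on_def
  proof (intro ballI impI)
    fix j j' :: nat assume "j \<noteq> j'"
    then have "y (prod_encode (i, j)) \<noteq> y (prod_encode (i', j'))" for i i'
      by (intro inj) simp
    then show "C j \<inter> C j' = {}" unfolding C_def by blast
  qed
  moreover have "C j \<inter> S n \<noteq> {}" for n j
    using y(1)[of "prod_encode (n, j)"] by (auto simp: C_def)
  ultimately show ?thesis by blast
qed

lemma disjoint_transversals_countable:
  assumes "countable \<S>" "\<And>S. S \<in> \<S> \<Longrightarrow> infinite S"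
  shows "\<exists>C::nat \<Rightarrow> 'a set. disjoint_family C \<and> (\<forall>S\<in>\<S>. \<forall>j. C j \<inter> S \<noteq> {})"
proof (cases "\<S> = {}")
  case True
  then show ?thesis by (intro exI[of _ "\<lambda>_. {}"]) (auto simp: disjoint_family_on_def)
next
  case False
  then have range: "range (from_nat_into \<S>) = \<S>" using assms(1) by (rule range_from_nat_into)
  then have "infinite (from_nat_into \<S> n)" for n using assms(2) by (metis rangeI)
  from disjoint_transversals[of "from_nat_into \<S>", OF this] obtain C :: "nat \<Rightarrow> 'a set"
    where C: "disjoint_family C" "\<And>n j. C j \<inter> from_nat_into \<S> n \<noteq> {}" by blast
  have "C j \<inter> S \<noteq> {}" if "S \<in> \<S>" for S j
  proof -
    have "S \<in> range (from_nat_into \<S>)" using that range by simp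
    then obtain n where "S = from_nat_into \<S> n" by blast
    then show ?thesis using C(2) by simp
  qed
  then show ?thesis using C(1) by blast
qed

lemma domatic_partition_countable_sections:
  fixes G :: "('a \<times> 'a) set"
  assumes "\<And>x. countable (G `` {x})" "\<And>x. countable (G\<inverse> `` {x})"
  shows "\<exists>C::nat \<Rightarrow> 'a set. disjoint_family C \<and>
    (\<forall>x. infinite (G `` {x}) \<longrightarrow> (\<forall>j. C j \<inter> G `` {x} \<noteq> {}))"
proof -
  define R where "R = (G \<union> G\<inverse>)\<^sup>*"
  define Q where "Q x = R `` {x}" for x
  have R_sym: "sym R" unfolding R_def by (intro sym_rtrancl) (auto simp: sym_def)
  have R_trans: "trans R" unfolding R_def by (rule trans_rtrancl)
  have Q_eq: "Q y = Q x" if "y \<in> Q x" for x y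
    using that symD[OF R_sym] transD[OF R_trans] unfolding Q_def by blast
  have refl: "x \<in> Q x" for x by (auto simp: Q_def R_def)
  have G_Q: "G `` {x} \<subseteq> Q x" for x by (auto simp: Q_def R_def)
  have "countable (Q x)" for x
    unfolding Q_def R_def
  proof (rule countable_rtrancl)
    fix Y :: "'a set" assume "countable Y"
    moreover have "(G \<union> G\<inverse>) `` Y = (\<Union>y\<in>Y. G `` {y} \<union> G\<inverse> `` {y})" by blast
    ultimately show "countable ((G \<union> G\<inverse>) `` Y)" using assms by (simp only: countable_UN countable_Un)
  qed simp
  then have "countable ((\<lambda>y. G `` {y}) ` {y \<in> Q x. infinite (G `` {y})})" for x
    by (intro countable_image) (auto intro: countable_subset[rotated])
  then have C: "\<exists>C::nat \<Rightarrow> 'a set. disjoint_family C \<and>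
      (\<forall>S\<in>(\<lambda>y. G `` {y}) ` {y \<in> Q x. infinite (G `` {y})}. \<forall>j. C j \<inter> S \<noteq> {})" for x
    by (rule disjoint_transversals_countable) auto
  \<comment> \<open>Classes are chosen for a component as a set, not for its vertices, so that all
    vertices of a component use the same ones.\<close>
  have "\<forall>E. \<exists>C::nat \<Rightarrow> 'a set. E \<in> range Q \<longrightarrow> disjoint_family C \<and>
      (\<forall>y\<in>E. infinite (G `` {y}) \<longrightarrow> (\<forall>j. C j \<inter> G `` {y} \<noteq> {}))"
  proof
    fix E
    show "\<exists>C::nat \<Rightarrow> 'a set. E \<in> range Q \<longrightarrow> disjoint_family C \<and>
      (\<forall>y\<in>E. infinite (G `` {y}) \<longrightarrow> (\<forall>j. C j \<inter> G `` {y} \<noteq> {}))"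
    proof (cases "E \<in> range Q")
      case True
      then obtain x where x: "E = Q x" by blast
      show ?thesis using C[of x] unfolding x by auto
    qed auto
  qed
  from choice[OF this] obtain C :: "'a set \<Rightarrow> nat \<Rightarrow> 'a set"
    where C_prop: "\<forall>E. E \<in> range Q \<longrightarrow> disjoint_family (C E) \<and>
      (\<forall>y\<in>E. infinite (G `` {y}) \<longrightarrow> (\<forall>j. C E j \<inter> G `` {y} \<noteq> {}))" ..
  then have C_disj: "disjoint_family (C (Q x))" for x by simp
  have C_meets: "C (Q x) j \<inter> G `` {y} \<noteq> {}" if "y \<in> Q x" "infinite (G `` {y})" for x y j
    using C_prop[rule_format, of "Q x"] that by simp
  define D where "D j = {y. y \<in> C (Q y) j}" for j
  have "disjoint_family D"
    using C_disj unfolding disjoint_family_on_def D_def by blast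
  moreover have "D j \<inter> G `` {x} \<noteq> {}" if "infinite (G `` {x})" for x j
  proof -
    obtain y where y: "y \<in> C (Q x) j" "y \<in> G `` {x}" using C_meets[OF refl \<open>infinite (G `` {x})\<close>, of j] by blast
    then have "Q y = Q x" using Q_eq G_Q by blast
    then have "y \<in> D j" using y(1) by (simp add: D_def)
    then show ?thesis using y(2) by blast
  qed
  ultimately show ?thesis by blast
qed

section \<open>Domatic partitions\<close>

theorem domatic_partition_polish:
  fixes G :: "('a::{complete_space, second_countable_topology} \<times> 'a) set"
  assumes M: "prob_space M" "sets M = sets borel" and G: "G \<in> sets borel"
    and out: "\<And>x. countable (G `` {x})" and inn: "\<And>x. countable (G\<inverse> `` {x})"
  shows "\<exists>D::nat \<Rightarrow> 'a set. (\<forall>j. D j \<in> sets (completion M)) \<and> disjoint_family D \<and>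
    (\<forall>x. infinite (G `` {x}) \<longrightarrow> (\<forall>j. D j \<inter> G `` {x} \<noteq> {}))"
proof -
  define H where "H = G \<union> G\<inverse>"
  have "prod.swap \<in> borel_measurable (borel :: ('a \<times> 'a) measure)"
    by (intro borel_measurable_continuous_onI continuous_on_swap)
  from measurable_sets[OF this G] have "prod.swap -` G \<in> sets borel" by simp
  also have "prod.swap -` G = G\<inverse>" by (auto simp: vimage_def converse_unfold)
  finally have H: "H \<in> sets borel" "sym H" using G by (auto simp: H_def sym_def)
  have H_sections: "countable (H `` {x})" for x
    using out inn by (simp add: H_def Un_Image)
  obtain N where N: "prob_space N" "sets N = sets borel" "null_sets N \<subseteq> null_sets M"
    "\<forall>Z\<in>null_sets N. \<exists>Y\<in>null_sets N. H\<inverse> `` Z \<subseteq> Y"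
    using quasi_invariant_measure[OF M H(1) H_sections] by (elim exE conjE) (rule that)
  interpret N: prob_space N by fact
  obtain f where f: "\<And>i::nat. f i \<in> borel_measurable N"
    "AE x in N. \<forall>y. (x, y) \<in> G \<longrightarrow> (\<exists>i. y = f i x)"
    using countable_sections_cover[OF N.finite_measure_axioms N(2) G out] by blast
  have "{x \<in> space N. (x, f i x) \<in> G} \<in> sets N" for i
  proof -
    have "(\<lambda>x. x) \<in> borel_measurable N" using N(2) by (simp add: measurable_ident_sets)
    then have "(\<lambda>x. (x, f i x)) \<in> borel_measurable N" using f(1) by (rule borel_measurable_Pair)
    from measurable_sets[OF this G] show ?thesis by (simp add: vimage_def Int_def conj_commute)
  qed
  from N.measurable_domatic_ae[OF f(1) this f(2)] obtain D :: "nat \<Rightarrow> 'a set"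
    where D: "\<And>j. D j \<in> sets borel" "disjoint_family D"
      "AE x in N. infinite (G `` {x}) \<longrightarrow> (\<forall>j. D j \<inter> G `` {x} \<noteq> {})" by blast
  obtain B where B: "{x \<in> space N. \<not> (infinite (G `` {x}) \<longrightarrow> (\<forall>j. D j \<inter> G `` {x} \<noteq> {}))} \<subseteq> B"
    "emeasure N B = 0" "B \<in> sets N"
    using D(3) by (rule AE_E)
  have B_null: "B \<in> null_sets N" using B(2,3) by (rule null_setsI)
  have "\<exists>Z\<in>null_sets N. B \<subseteq> Z \<and> (\<forall>(x, y)\<in>H. x \<in> Z \<longleftrightarrow> y \<in> Z)"
    by (rule invariant_null_hull[OF H(2) _ B_null]) (use N(4) in blast)
  then obtain Z where Z: "Z \<in> null_sets N" "B \<subseteq> Z" "\<forall>(x, y)\<in>H. x \<in> Z \<longleftrightarrow> y \<in> Z" by blast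
  have inv: "y \<in> Z \<longleftrightarrow> x \<in> Z" if "(x, y) \<in> G" for x y
    using that Z(3) by (auto simp: H_def)
  obtain C :: "nat \<Rightarrow> 'a set" where C: "disjoint_family C"
    "\<And>x j. infinite (G `` {x}) \<Longrightarrow> C j \<inter> G `` {x} \<noteq> {}"
    using domatic_partition_countable_sections[OF out inn] by blast
  \<comment> \<open>No edge crosses the border of \<open>Z\<close>, so an out-neighbourhood lies
    wholly on the side of its vertex and the two families can be glued.\<close>
  define E where "E j = (D j - Z) \<union> (C j \<inter> Z)" for j
  have Z_null: "Z \<in> null_sets M" using Z(1) N(3) by blast
  \<comment> \<open>The sets \<open>C j\<close> come from choice without any measurability; they
    enter only inside \<open>Z\<close>, which is null for \<open>M\<close> as well as for
    \<open>N\<close>.\<close>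
  have "E j \<in> sets (completion M)" for j
    using Z_null D(1)[of j] M(2)
    by (intro sets_completionI[of "E j" "D j - Z" "C j \<inter> Z" Z]) (auto simp: E_def null_sets_def)
  moreover have "disjoint_family E"
    using D(2) C(1) unfolding disjoint_family_on_def E_def by blast
  moreover have "E j \<inter> G `` {x} \<noteq> {}" if inf: "infinite (G `` {x})" for x j
  proof (cases "x \<in> Z")
    case True
    then show ?thesis using C(2)[OF inf, of j] inv by (auto simp: E_def)
  next
    case False
    then have "D j \<inter> G `` {x} \<noteq> {}"
      using B(1) Z(2) inf sets_eq_imp_space_eq[OF N(2)] by auto
    then show ?thesis using False inv by (auto simp: E_def)
  qed
  ultimately show ?thesis by blast
qed

section \<open>Transfer from a standard Borel space to sequences of reals\<close>

lemma polish_embedding: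
  assumes T: "completely_metrizable_space T" "second_countable T" and x0: "x0 \<in> topspace T"
  shows "\<exists>e :: 'a \<Rightarrow> nat \<Rightarrow> real. embedding_map T euclidean e \<and> e ` topspace T \<in> sets borel"
proof -
  obtain X d where Xd: "Metric_space X d" "T = Metric_space.mtopology X d"
    using completely_metrizable_imp_metrizable_space[OF T(1)] unfolding metrizable_space_def by blast
  interpret Metric_space X d by fact
  have X: "topspace T = X" using Xd(2) by simp
  obtain \<B> where \<B>: "countable \<B>" "\<forall>U x. openin T U \<and> x \<in> U \<longrightarrow> (\<exists>V\<in>\<B>. x \<in> V \<and> V \<subseteq> U)"
    using T(2) unfolding second_countable_def by blast
  \<comment> \<open>One point from each basic set gives a dense sequence; \<open>x0\<close> fills in
    where a set misses \<open>X\<close>.\<close>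
  define q where "q n = (let V = from_nat_into \<B> n in if V \<inter> X = {} then x0 else SOME y. y \<in> V \<inter> X)" for n
  have q: "q n \<in> X" for n
    using x0 X some_in_eq[of "from_nat_into \<B> n \<inter> X"] by (auto simp: q_def Let_def)
  have dense: "\<exists>n. d x (q n) < r" if x: "x \<in> X" and "0 < r" for x r
  proof -
    have "openin T (mball x r)" "x \<in> mball x r" using Xd(2) x \<open>0 < r\<close> by auto
    then obtain V where V: "V \<in> \<B>" "x \<in> V" "V \<subseteq> mball x r" using \<B>(2) by blast
    then obtain n where n: "from_nat_into \<B> n = V" using from_nat_into_surj[OF \<B>(1)] by blast
    have "q n \<in> V"
      using V(2) x some_in_eq[of "V \<inter> X"] by (auto simp: q_def n Let_def)
    then have "q n \<in> mball x r" using V(3) by blast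
    then show ?thesis by auto
  qed
  define e where "e x n = d x (q n)" for x n
  \<comment> \<open>One coordinate suffices: if \<open>q n\<close> is within \<open>r / 2\<close> of
    both points, their distance is below \<open>r\<close>. Injectivity and openness onto the image
    both rest on this.\<close>
  have ball_iff: "\<exists>Y. open Y \<and> e x \<in> Y \<and> (\<forall>y\<in>X. e y \<in> Y \<longrightarrow> d x y < r)" if x: "x \<in> X" and r: "0 < r" for x r
  proof -
    obtain n where n: "d x (q n) < r / 2" using dense[OF x, of "r / 2"] r by auto
    have "open ((\<lambda>p::nat \<Rightarrow> real. p n) -` {..<r / 2})"
      by (intro open_vimage continuous_on_product_coordinates) auto
    moreover have "d x y < r" if "y \<in> X" "d y (q n) < r / 2" for y
      using triangle'[OF x q \<open>y \<in> X\<close>, of n] n that(2) by linarith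
    ultimately show ?thesis using n by (intro exI[of _ "(\<lambda>p. p n) -` {..<r / 2}"]) (auto simp: e_def)
  qed
  have inj: "inj_on e X"
  proof (rule inj_onI, rule ccontr)
    fix x y assume xy: "x \<in> X" "y \<in> X" "e x = e y" "x \<noteq> y"
    then show False using ball_iff[OF xy(1), of "d x y"] by auto
  qed
  have "continuous_map T euclidean (\<lambda>x. e x n)" for n
    unfolding continuous_map_def
  proof (intro conjI allI impI)
    fix U :: "real set" assume U: "openin euclidean U"
    have "\<exists>r>0. mball x r \<subseteq> {x \<in> X. e x n \<in> U}" if x: "x \<in> X" "e x n \<in> U" for x
    proof -
      obtain r where r: "0 < r" "ball (e x n) r \<subseteq> U" using U x(2) openE by auto
      have "e y n \<in> U" if "y \<in> mball x r" for y
      proof -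
        have "y \<in> X" "d x y < r" using that by auto
        then have "\<bar>e x n - e y n\<bar> < r"
          using mdist_reverse_triangle[OF x(1) q[of n] \<open>y \<in> X\<close>] by (simp add: e_def commute[of y])
        then show ?thesis using r(2) by (auto simp: dist_real_def)
      qed
      then show ?thesis using r(1) by auto
    qed
    then show "openin T {x \<in> topspace T. e x n \<in> U}"
      unfolding X unfolding Xd(2) openin_mtopology by auto
  qed simp
  then have "continuous_map T (product_topology (\<lambda>_. euclidean) UNIV) e"
    by (simp add: continuous_map_componentwise_UNIV)
  then have cont: "continuous_map T euclidean e" by (simp add: euclidean_product_topology)
  have "open_map T (subtopology euclidean (e ` X)) e"
    unfolding open_map_def
  proof (intro allI impI)
    fix U assume U: "openin T U"
    have UX: "U \<subseteq> X" using openin_subset[OF U] X by simp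
    have "\<forall>x\<in>U. \<exists>Y. open Y \<and> e x \<in> Y \<and> Y \<inter> e ` X \<subseteq> e ` U"
    proof
      fix x assume x: "x \<in> U"
      then obtain r where r: "0 < r" "mball x r \<subseteq> U" using U unfolding Xd(2) openin_mtopology by blast
      have "x \<in> X" using x UX by blast
      from ball_iff[OF this r(1)] obtain Y where Y: "open Y" "e x \<in> Y" "\<forall>y\<in>X. e y \<in> Y \<longrightarrow> d x y < r" by blast
      have "y \<in> U" if "y \<in> X" "e y \<in> Y" for y
      proof -
        have "y \<in> mball x r" using Y(3) that \<open>x \<in> X\<close> by simp
        then show ?thesis using r(2) by blast
      qed
      then have "Y \<inter> e ` X \<subseteq> e ` U" by blast
      then show "\<exists>Y. open Y \<and> e x \<in> Y \<and> Y \<inter> e ` X \<subseteq> e ` U" using Y by blast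
    qed
    from bchoice[OF this] obtain W where W: "\<forall>x\<in>U. open (W x) \<and> e x \<in> W x \<and> W x \<inter> e ` X \<subseteq> e ` U" ..
    then have "e ` U = (\<Union>x\<in>U. W x) \<inter> e ` X" using UX by blast
    moreover have "open (\<Union>x\<in>U. W x)" using W by blast
    ultimately show "openin (subtopology euclidean (e ` X)) (e ` U)"
      by (auto simp: openin_subtopology)
  qed
  then have emb: "embedding_map T euclidean e"
    unfolding embedding_map_def using cont inj X
    by (intro bijective_open_imp_homeomorphic_map) (auto simp: continuous_map_in_subtopology)
  then have "T homeomorphic_space subtopology euclidean (e ` X)"
    unfolding embedding_map_def X by (rule homeomorphic_map_imp_homeomorphic_space)
  \<comment> \<open>A completely metrizable subspace of a metrizable space is a G-delta set, which
    makes the image Borel.\<close>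
  then have "completely_metrizable_space (subtopology euclidean (e ` X))"
    using T(1) homeomorphic_completely_metrizable_space by blast
  then have "gdelta_in euclidean (e ` X)"
    by (intro completely_metrizable_space_imp_gdelta_in) (auto intro: metrizable_space_euclidean)
  then obtain C where C: "\<And>n::nat. open (C n)" "\<Inter>(range C) = e ` X"
    unfolding gdelta_in_descending open_openin[symmetric] by blast
  have "e ` X \<in> sets borel" unfolding C(2)[symmetric] using C(1) by (intro sets.countable_INT) auto
  then show ?thesis using emb X by blast
qed

text \<open>Embedding the vertex set as a Borel set of real sequences replaces the abstract space by
  a Polish type. The copied graph has empty sections off the image, which is why
  \<open>domatic_partition_polish\<close> speaks only of vertices with infinite
  out-neighbourhood.\<close>

theorem theorem1p6:
  fixes M :: "'a measure" and G :: "('a \<times> 'a) set"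
  assumes "borel_probability_space M"
    and "borel_graph M G"
    and "out_degree_aleph0_regular M G"
    and "countable_in_degrees M G"
  shows "\<exists>D. measurable_domatic_aleph0_partition M G D"
proof -
  interpret prob_space M using assms(1) by (simp add: borel_probability_space_def)
  define X where "X = space M"
  obtain T where T: "topspace T = X" "completely_metrizable_space T" "second_countable T"
    "sets M = sigma_sets X {U. openin T U}"
    using assms(1) by (auto simp: borel_probability_space_def standard_borel_space_def X_def)
  obtain x0 where x0: "x0 \<in> X" using not_empty by (auto simp: X_def)
  obtain e :: "'a \<Rightarrow> nat \<Rightarrow> real" where e: "embedding_map T euclidean e" "e ` X \<in> sets borel"
    using polish_embedding[OF T(2,3), of x0] x0 T(1) by auto
  then have hom: "homeomorphic_map T (top_of_set (e ` X)) e" by (simp add: embedding_map_def T(1))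
  have inj: "inj_on e X" using homeomorphic_imp_injective_map[OF hom] by (simp add: T(1))
  have e_meas [measurable]: "e \<in> borel_measurable M"
  proof (rule borel_measurableI)
    fix S :: "(nat \<Rightarrow> real) set" assume "open S"
    then have "openin T {x \<in> topspace T. e x \<in> S}"
      using homeomorphic_imp_continuous_map[OF hom]
      by (intro openin_continuous_map_preimage[of T euclidean]) (auto simp: continuous_map_in_subtopology)
    then have "{x \<in> topspace T. e x \<in> S} \<in> sets M" unfolding T(4) by blast
    also have "{x \<in> topspace T. e x \<in> S} = e -` S \<inter> space M" by (auto simp: T(1) X_def)
    finally show "e -` S \<inter> space M \<in> sets M" .
  qed
  \<comment> \<open>A left inverse of \<open>e\<close>, made total by a fixed vertex
    \<open>x0\<close> so that it maps every sequence into \<open>X\<close>.\<close>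
  define r where "r p = (if p \<in> e ` X then inv_into X e p else x0)" for p
  have r_e: "r (e x) = x" if "x \<in> X" for x
    using that inj by (auto simp: r_def)
  have r_meas [measurable]: "r \<in> borel \<rightarrow>\<^sub>M M"
  proof (rule measurable_sigma_sets[OF T(4)])
    show "{U. openin T U} \<subseteq> Pow X" using openin_subset T(1) by blast
    show "r \<in> space borel \<rightarrow> X" using x0 by (auto simp: r_def inv_into_into)
    fix U assume "U \<in> {U. openin T U}"
    then have U: "openin T U" "U \<subseteq> X" using openin_subset T(1) by blast+
    have "openin (top_of_set (e ` X)) (e ` U)"
      using homeomorphic_imp_open_map[OF hom] U(1) by (simp add: open_map_def)
    then obtain V where "open V" "e ` U = e ` X \<inter> V" by (auto simp: openin_open)
    then have eU: "e ` U \<in> sets borel" using e(2) by auto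
    have "r -` U \<inter> space borel = e ` U \<union> (if x0 \<in> U then - e ` X else {})"
    proof (intro set_eqI)
      fix p show "p \<in> r -` U \<inter> space borel \<longleftrightarrow> p \<in> e ` U \<union> (if x0 \<in> U then - e ` X else {})"
      proof (cases "p \<in> e ` X")
        case True
        then obtain x where "x \<in> X" "p = e x" by blast
        then show ?thesis using r_e inj U(2) by (auto dest: inj_onD)
      next
        case False
        then show ?thesis using U(2) by (auto simp: r_def)
      qed
    qed
    then show "r -` U \<inter> space borel \<in> sets borel" using eU e(2) by auto
  qed
  \<comment> \<open>Both ends are required to lie in the image; otherwise sequences outside it would
    inherit the edges of \<open>x0\<close>.\<close>
  define G' where "G' = {p. fst p \<in> e ` X \<and> snd p \<in> e ` X \<and> (r (fst p), r (snd p)) \<in> G}"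
  have "G' \<in> sets (borel \<Otimes>\<^sub>M borel)"
  proof -
    have [measurable]: "G \<in> sets (M \<Otimes>\<^sub>M M)" "e ` X \<in> sets borel"
      using assms(2) e(2) by (auto simp: borel_graph_def)
    have "{p \<in> space (borel \<Otimes>\<^sub>M borel). fst p \<in> e ` X \<and> snd p \<in> e ` X \<and> (r (fst p), r (snd p)) \<in> G}
        \<in> sets (borel \<Otimes>\<^sub>M borel)"
      by measurable
    then show ?thesis by (simp add: G'_def space_pair_measure)
  qed
  then have G'_borel: "G' \<in> sets borel" by (simp only: borel_prod)
  have G'_iff: "(e x, e y) \<in> G' \<longleftrightarrow> (x, y) \<in> G" if "x \<in> X" "y \<in> X" for x y
    using that by (simp add: G'_def r_e)
  have G'_sub: "p \<in> e ` X \<and> q \<in> e ` X" if "(p, q) \<in> G'" for p q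
    using that by (simp add: G'_def)
  have out_G': "G' `` {e x} = e ` out_nbhd M G x" if "x \<in> X" for x
  proof (intro set_eqI iffI)
    fix q assume q: "q \<in> G' `` {e x}"
    then obtain y where "y \<in> X" "q = e y" using G'_sub by blast
    then show "q \<in> e ` out_nbhd M G x"
      using q G'_iff[OF that] by (auto simp: out_nbhd_def X_def)
  qed (use that G'_iff in \<open>auto simp: out_nbhd_def X_def\<close>)
  have in_G': "G'\<inverse> `` {e x} = e ` in_nbhd M G x" if "x \<in> X" for x
  proof (intro set_eqI iffI)
    fix q assume q: "q \<in> G'\<inverse> `` {e x}"
    then obtain y where "y \<in> X" "q = e y" using G'_sub by blast
    then show "q \<in> e ` in_nbhd M G x"
      using q G'_iff[OF _ that] by (auto simp: in_nbhd_def X_def)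
  qed (use that G'_iff in \<open>auto simp: in_nbhd_def X_def\<close>)
  have outside: "G' `` {p} = {}" "G'\<inverse> `` {p} = {}" if "p \<notin> e ` X" for p
    using that by (auto simp: G'_def)
  have out: "out_nbhd M G x \<approx> (UNIV :: nat set)" if "x \<in> X" for x
    using that assms(3) by (simp add: out_degree_aleph0_regular_def X_def)
  have "countable (out_nbhd M G x)" if "x \<in> X" for x
    using eqpoll_imp_lepoll[OF out[OF that]] by (auto simp: lepoll_def countable_def)
  then have "countable (G' `` {p})" for p
    using outside(1)[of p] out_G' by (cases "p \<in> e ` X") auto
  moreover have "countable (in_nbhd M G x)" if "x \<in> X" for x
    using that assms(4) by (simp add: countable_in_degrees_def X_def)
  then have "countable (G'\<inverse> `` {p})" for p
    using outside(2)[of p] in_G' by (cases "p \<in> e ` X") auto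
  ultimately have "\<exists>E::nat \<Rightarrow> (nat \<Rightarrow> real) set. (\<forall>j. E j \<in> sets (completion (distr M borel e))) \<and>
      disjoint_family E \<and> (\<forall>p. infinite (G' `` {p}) \<longrightarrow> (\<forall>j. E j \<inter> G' `` {p} \<noteq> {}))"
    by (intro domatic_partition_polish prob_space_distr e_meas G'_borel) auto
  then obtain E :: "nat \<Rightarrow> (nat \<Rightarrow> real) set" where E: "\<forall>j. E j \<in> sets (completion (distr M borel e))"
    "disjoint_family E" "\<forall>p. infinite (G' `` {p}) \<longrightarrow> (\<forall>j. E j \<inter> G' `` {p} \<noteq> {})" by blast
  define D where "D j = e -` E j \<inter> X" for j
  have "D j \<in> sets (completion M)" for j
  proof -
    \<comment> \<open>A set of the completion is a measurable set joined with a part of a null set;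
      preimages under \<open>e\<close> respect this decomposition.\<close>
    obtain S N N' where N: "E j = S \<union> N" "N \<subseteq> N'" "N' \<in> null_sets (distr M borel e)" "S \<in> sets (distr M borel e)"
      using E(1) by (meson sets_completionE)
    have "e -` N' \<inter> X \<in> null_sets M"
      using N(3) by (auto simp: null_sets_def emeasure_distr X_def)
    moreover have "e -` S \<inter> X \<in> sets M"
      using N(4) by (auto simp: X_def)
    ultimately show ?thesis
      using N(1,2) by (intro sets_completionI[of _ "e -` S \<inter> X" "e -` N \<inter> X" "e -` N' \<inter> X"]) (auto simp: D_def)
  qed
  moreover have "disjoint_family D"
    using E(2) unfolding disjoint_family_on_def D_def by blast
  moreover have "D j \<inter> out_nbhd M G x \<noteq> {}" if "x \<in> space M" for x j
  proof -
    have x: "x \<in> X" using that by (simp add: X_def)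
    have sub: "out_nbhd M G x \<subseteq> X" by (auto simp: out_nbhd_def X_def)
    have "infinite (out_nbhd M G x)"
      using out[OF x] eqpoll_finite_iff by blast
    then have "infinite (G' `` {e x})"
      using out_G'[OF x] finite_imageD inj_on_subset[OF inj sub] by metis
    then have "E j \<inter> G' `` {e x} \<noteq> {}" using E(3) by blast
    then have "E j \<inter> e ` out_nbhd M G x \<noteq> {}" unfolding out_G'[OF x] .
    then show ?thesis using sub by (auto simp: D_def)
  qed
  ultimately show ?thesis
    unfolding measurable_domatic_aleph0_partition_def by blast
qed

end
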